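(* Let $\mathcal{F}=\mathbb{Q}(x,y,z)$ and $\mathcal{L}=\mathbb{Q}[x^{\pm1},y^{\pm1},z^{\pm1}]$. For each $i\in\{1,2,3\}$, $$\mathcal{F}^{\Gamma_{B_i}}=\mathbb{Q}(\mathcal{T}_i),\qquad \mathcal{F}^{\Gamma_{B_i}}\cap\mathcal{L}=\mathbb{Q}[\mathcal{T}_i].$$ In particular, up to a permutation of the variables, every Laurent mutation invariant of the cluster algebra with exchange matrix $B_i$ is a polynomial in $\mathcal{T}_i$.
   Context: Set $$B_1=\begin{pmatrix}0&2&-2\\-2&0&2\\2&-2&0\end{pmatrix},\quad B_2=\begin{pmatrix}0&1&-1\\-4&0&2\\4&-2&0\end{pmatrix},\quad B_3=\begin{pmatrix}0&4&-4\\-1&0&2\\1&-2&0\end{pmatrix},$$ $$\mathcal{T}_1=\frac{x^2+y^2+z^2}{xyz},\quad \mathcal{T}_2=\frac{x^2+y^4+z^4+2xy^2+2xz^2}{xy^2z^2},\quad \mathcal{T}_3=\frac{x^4+y^2+z^2+2yz}{x^2yz}.$$ $\Gamma_{B_i}=\langle\mu_1,\mu_2,\mu_3\rangle$ is the classical cluster mutation group, whose generators are (they do not change when $B_i$ is replaced by $-B_i$, and the mutation class of $B_i$ is $\{B_i,-B_i\}$): - $B_1$: $\mu_1(x,y,z)=(\frac{y^2+z^2}{x},y,z)$, $\mu_2(x,y,z)=(x,\frac{x^2+z^2}{y},z)$, $\mu_3(x,y,z)=(x,y,\frac{x^2+y^2}{z})$; - $B_2$: $\mu_1(x,y,z)=(\frac{y^4+z^4}{x},y,z)$,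 $\mu_2(x,y,z)=(x,\frac{x+z^2}{y},z)$, $\mu_3(x,y,z)=(x,y,\frac{x+y^2}{z})$; - $B_3$: $\mu_1(x,y,z)=(\frac{y+z}{x},y,z)$, $\mu_2(x,y,z)=(x,\frac{x^4+z^2}{y},z)$, $\mu_3(x,y,z)=(x,y,\frac{x^4+y^2}{z})$. $\mathcal{F}^{\Gamma_{B_i}}=\{f\in\mathcal{F}\mid f(\mu_j(x,y,z))=f,\ j=1,2,3\}$. A Laurent mutation invariant is a non-constant element of $\mathcal{F}^{\Gamma_{B_i}}\cap\mathcal{L}$. "Up to a permutation of the variables" means that the assertion is also made for each matrix $\sigma(B_i)$, $\sigma\in\mathfrak{S}_3$, with entries $\sigma(B)_{ab}=b_{\sigma^{-1}(a)\sigma^{-1}(b)}$, with $\mathcal{T}_i(x_1,x_2,x_3)$ replaced by $\mathcal{T}_i(x_{\sigma(1)},x_{\sigma(2)},x_{\sigma(3)})$ (where $(x_1,x_2,x_3)=(x,y,z)$) and the mutations relabelled accordingly. *)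

theory Defs
  imports "HOL-Analysis.Analysis" "HOL-Computational_Algebra.Polynomial_Factorial"
    "HOL-Computational_Algebra.Field_as_Ring"
begin

section \<open>The rational function field in three variables\<close>

text \<open>
  The polynomial ring in three variables over the rationals is the iterated type
  \<open>rat poly poly poly\<close>: the innermost variable is \<open>x\<close>, the outermost is \<open>z\<close>. Variables, and the
  rows and columns of exchange matrices, are indexed by the three-element type \<open>3\<close>, so a triple of
  rational functions is a function \<open>3 \<Rightarrow> ratfun\<close>.
\<close>

type_synonym pol3 = "rat poly poly poly"

type_synonym ratfun = "pol3 fract"

definition emb :: "rat \<Rightarrow> ratfun"
  where "emb c = to_fract [:[:[:c:]:]:]"

definition X :: "3 \<Rightarrow> ratfun"
  where "X i = (if i = 1 then to_fract [:[:[:0, 1:]:]:]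
                else if i = 2 then to_fract [:[:0, 1:]:]
                else to_fract [:0, 1:])"

definition poly_at :: "rat poly \<Rightarrow> ratfun \<Rightarrow> ratfun"
  where "poly_at p t = poly (map_poly emb p) t"

definition pol3_at :: "pol3 \<Rightarrow> (3 \<Rightarrow> ratfun) \<Rightarrow> ratfun"
  where "pol3_at p a =
    poly (map_poly (\<lambda>q. poly (map_poly (\<lambda>r. poly_at r (a 1)) q) (a 2)) p) (a 3)"

text \<open>
  The substitution \<open>f(a\<^sub>1, a\<^sub>2, a\<^sub>3)\<close>, computed from the reduced fraction of \<open>f\<close>. Like every
  division by zero, it has the junk value \<open>0\<close> if the reduced denominator vanishes at \<open>a\<close>.
\<close>

definition subst3 :: "ratfun \<Rightarrow> (3 \<Rightarrow> ratfun) \<Rightarrow> ratfun"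
  where "subst3 f a = (case quot_of_fract f of (p, q) \<Rightarrow> pol3_at p a / pol3_at q a)"

definition laurent_monom :: "(3 \<Rightarrow> int) \<Rightarrow> ratfun"
  where "laurent_monom e = (\<Prod>i\<in>UNIV. X i powi e i)"

definition laurent_ring :: "ratfun set"
  where "laurent_ring = {\<Sum>e\<in>S. emb (c e) * laurent_monom e | S c. finite S}"

definition poly_ring_of :: "ratfun \<Rightarrow> ratfun set"
  where "poly_ring_of t = {poly_at p t | p. True}"

definition ratfun_field_of :: "ratfun \<Rightarrow> ratfun set"
  where "ratfun_field_of t = {poly_at p t / poly_at q t | p q. poly_at q t \<noteq> 0}"


section \<open>Cluster mutations and their invariants\<close>

text \<open>
  The exchange relation of the cluster algebra at the initial seed with exchange matrix \<open>B\<close>,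
  read off from the \<open>k\<close>-th column of \<open>B\<close>. The truncating conversion \<open>nat b\<close> is \<open>max b 0\<close>.
\<close>

definition mutation :: "int^3^3 \<Rightarrow> 3 \<Rightarrow> 3 \<Rightarrow> ratfun"
  where "mutation B k i =
    (if i = k
     then ((\<Prod>j\<in>UNIV. X j ^ nat (B $ j $ k)) + (\<Prod>j\<in>UNIV. X j ^ nat (- (B $ j $ k)))) / X k
     else X i)"

text \<open>Being fixed by the mutation group is the same as being fixed by its three generators.\<close>

definition invariant_field :: "int^3^3 \<Rightarrow> ratfun set"
  where "invariant_field B = {f. \<forall>k. subst3 f (mutation B k) = f}"

definition laurent_mutation_invariant :: "int^3^3 \<Rightarrow> ratfun \<Rightarrow> bool"
  where "laurent_mutation_invariant B f \<longleftrightarrow>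
    f \<in> invariant_field B \<inter> laurent_ring \<and> f \<notin> range emb"

definition permute_matrix :: "(3 \<Rightarrow> 3) \<Rightarrow> int^3^3 \<Rightarrow> int^3^3"
  where "permute_matrix \<sigma> B = (\<chi> a b. B $ inv \<sigma> a $ inv \<sigma> b)"


section \<open>The three exchange matrices and invariants\<close>

definition B1 :: "int^3^3"
  where "B1 = vector [vector [0, 2, -2], vector [-2, 0, 2], vector [2, -2, 0]]"

definition B2 :: "int^3^3"
  where "B2 = vector [vector [0, 1, -1], vector [-4, 0, 2], vector [4, -2, 0]]"

definition B3 :: "int^3^3"
  where "B3 = vector [vector [0, 4, -4], vector [-1, 0, 2], vector [1, -2, 0]]"

definition T1 :: "ratfun \<Rightarrow> ratfun \<Rightarrow> ratfun \<Rightarrow> ratfun"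
  where "T1 x y z = (x^2 + y^2 + z^2) / (x * y * z)"

definition T2 :: "ratfun \<Rightarrow> ratfun \<Rightarrow> ratfun \<Rightarrow> ratfun"
  where "T2 x y z = (x^2 + y^4 + z^4 + 2 * x * y^2 + 2 * x * z^2) / (x * y^2 * z^2)"

definition T3 :: "ratfun \<Rightarrow> ratfun \<Rightarrow> ratfun \<Rightarrow> ratfun"
  where "T3 x y z = (x^4 + y^2 + z^2 + 2 * y * z) / (x^2 * y * z)"


section \<open>Consistency of the definitions\<close>

lemma emb_simps [simp]:
  "emb 0 = 0" "emb 1 = 1" "emb (a + b) = emb a + emb b" "emb (a * b) = emb a * emb b"
proof -
  have "[:[:[:1:]:]:] = (1 :: pol3)"
    by (simp only: one_pCons)
  then show "emb 0 = 0" "emb 1 = 1"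
    by (simp_all add: emb_def)
  have "[:[:[:a + b:]:]:] = [:[:[:a:]:]:] + ([:[:[:b:]:]:] :: pol3)"
    by simp
  then show "emb (a + b) = emb a + emb b"
    unfolding emb_def by (simp only: to_fract_add)
  have "[:[:[:a * b:]:]:] = [:[:[:a:]:]:] * ([:[:[:b:]:]:] :: pol3)"
    by simp
  then show "emb (a * b) = emb a * emb b"
    unfolding emb_def by (simp only: to_fract_mult)
qed

lemma map_poly_hom_add:
  assumes "h 0 = 0" "\<And>a b. h (a + b) = h a + h b"
  shows "map_poly h (p + q) = map_poly h p + map_poly h q"
  by (rule poly_eqI) (simp add: coeff_map_poly assms)

lemma poly_map_poly_hom_mult:
  fixes h :: "'a::comm_ring_1 \<Rightarrow> 'b::comm_ring_1"
  assumes "h 0 = 0" "\<And>a b. h (a + b) = h a + h b" "\<And>a b. h (a * b) = h a * h b"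
  shows "poly (map_poly h (p * q)) t = poly (map_poly h p) t * poly (map_poly h q) t"
proof (induction p)
  case 0
  show ?case by simp
next
  case (pCons a p)
  have "map_poly h (smult a q) = smult (h a) (map_poly h q)"
    by (rule poly_eqI) (simp add: coeff_map_poly assms)
  with pCons show ?case
    by (simp add: map_poly_hom_add map_poly_pCons assms algebra_simps)
qed

lemma poly_at_simps [simp]:
  "poly_at 0 t = 0" "poly_at (p + q) t = poly_at p t + poly_at q t"
  "poly_at (p * q) t = poly_at p t * poly_at q t"
  by (simp_all add: poly_at_def map_poly_hom_add poly_map_poly_hom_mult)

lemma pol3_at_mult: "pol3_at (p * q) a = pol3_at p a * pol3_at q a"
  unfolding pol3_at_def
  by (intro poly_map_poly_hom_mult) (simp_all add: map_poly_hom_add poly_map_poly_hom_mult)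

lemma subst3_Fract:
  assumes "pol3_at q a \<noteq> 0"
  shows "subst3 (Fract p q) a = pol3_at p a / pol3_at q a"
proof -
  have "q \<noteq> 0"
    using assms by (auto simp: pol3_at_def)
  then obtain d where d: "p = fst (normalize_quot (p, q)) * d" "q = snd (normalize_quot (p, q)) * d"
    by (rule normalize_quotE[of q p])
  have "quot_of_fract (Fract p q) = normalize_quot (p, q)"
    using quot_of_fract_quot_to_fract[of "(p, q)"] by (simp add: quot_to_fract_def)
  moreover have "pol3_at p a = pol3_at (fst (normalize_quot (p, q))) a * pol3_at d a"
    and q: "pol3_at q a = pol3_at (snd (normalize_quot (p, q))) a * pol3_at d a"
    using d by (metis pol3_at_mult)+
  moreover have "pol3_at d a \<noteq> 0"
    using assms q by auto
  ultimately show ?thesis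
    by (simp add: subst3_def case_prod_unfold)
qed

lemma pol3_at_1: "pol3_at 1 a = 1"
proof -
  have "poly_at 1 t = 1" for t
    by (simp add: poly_at_def map_poly_1')
  then show ?thesis
    by (simp add: pol3_at_def map_poly_1')
qed

lemma subst3_to_fract: "subst3 (to_fract p) a = pol3_at p a"
  by (simp add: to_fract_def subst3_Fract pol3_at_1)

lemma subst3_emb: "subst3 (emb c) a = emb c"
proof -
  have "pol3_at [:[:[:c:]:]:] a = emb c"
    by (simp add: pol3_at_def poly_at_def map_poly_pCons)
  then show ?thesis
    by (simp add: emb_def subst3_to_fract)
qed

lemma subst3_X: "subst3 (X i) a = a i"
proof -
  have 1: "poly_at 1 t = 1" "poly_at [:0, 1:] t = t" for t
    by (simp_all add: poly_at_def map_poly_1' map_poly_pCons)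
  have "pol3_at [:[:[:0, 1:]:]:] a = a 1" "pol3_at [:[:0, 1:]:] a = a 2" "pol3_at [:0, 1:] a = a 3"
    by (simp_all add: pol3_at_def map_poly_pCons map_poly_1' 1)
  then show ?thesis
    using exhaust_3[of i] by (auto simp: X_def subst3_to_fract)
qed

lemma prod_UNIV_3: "(\<Prod>j\<in>UNIV. f j) = f 1 * f 2 * f (3::3)"
  unfolding UNIV_3 by (simp add: mult.assoc)

lemma mutation_B1:
  "mutation B1 1 1 = ((X 2)^2 + (X 3)^2) / X 1"
  "mutation B1 2 2 = ((X 1)^2 + (X 3)^2) / X 2"
  "mutation B1 3 3 = ((X 1)^2 + (X 2)^2) / X 3"
  by (simp_all add: mutation_def B1_def prod_UNIV_3 add.commute)

lemma mutation_B2: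
  "mutation B2 1 1 = ((X 2)^4 + (X 3)^4) / X 1"
  "mutation B2 2 2 = (X 1 + (X 3)^2) / X 2"
  "mutation B2 3 3 = (X 1 + (X 2)^2) / X 3"
  by (simp_all add: mutation_def B2_def prod_UNIV_3 add.commute)

lemma mutation_B3:
  "mutation B3 1 1 = (X 2 + X 3) / X 1"
  "mutation B3 2 2 = ((X 1)^4 + (X 3)^2) / X 2"
  "mutation B3 3 3 = ((X 1)^4 + (X 2)^2) / X 3"
  by (simp_all add: mutation_def B3_def prod_UNIV_3 add.commute)

lemma mutation_other: "i \<noteq> k \<Longrightarrow> mutation B k i = X i"
  by (simp add: mutation_def)

lemma mutation_uminus: "mutation (- B) k = mutation B k"
  by (rule ext) (simp only: mutation_def vector_uminus_component minus_minus add.commute)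

end

theory Submission
  imports Defs
begin

text \<open>
  Suppose that two substitutions fix \<open>f\<close> and the coefficients of \<open>A\<close> and \<open>B\<close>, and that together
  they move an element \<open>p\<close> through infinitely many values. If \<open>f = A(p) / B(p)\<close>, then the
  polynomial \<open>A - f B\<close> has infinitely many roots, so \<open>f\<close> is a quotient of coefficients. For an
  invariant \<open>f\<close> this is used twice: first with \<open>p = z\<close>, the mutations of \<open>y\<close> and \<open>z\<close> acting by
  \<open>y' = s z - y\<close>, \<open>z' = s y - z\<close> with \<open>s\<close> fixed, which gives \<open>f \<in> \<rat>(x, s)\<close>; then over
  \<open>\<rat>(T)\<close> with a generator of \<open>\<rat>(x, s)\<close> and the mutations of \<open>x\<close> and \<open>y\<close>. That orbits are
  infinite is read off at the point \<open>(1, 1, 1)\<close>.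
\<close>

section \<open>The rational constants as a subfield\<close>

lemma emb_eq_iff [simp]: "emb a = emb b \<longleftrightarrow> a = b"
  by (simp add: emb_def)

lemma emb_minus [simp]: "emb (- a) = - emb a"
  by (rule minus_unique[symmetric]) (simp flip: emb_simps)

lemma emb_diff [simp]: "emb (a - b) = emb a - emb b"
  using emb_simps(3)[of a "- b"] by simp

lemma emb_of_nat [simp]: "emb (of_nat n) = of_nat n"
  by (induction n) simp_all

lemma emb_numeral [simp]: "emb (numeral n) = numeral n"
  using emb_of_nat[of "numeral n"] by simp

lemma emb_inverse [simp]: "emb (inverse a) = inverse (emb a)"
proof (cases "a = 0")
  case False
  then have "emb a * emb (inverse a) = 1"
    by (simp flip: emb_simps(4))
  then show ?thesis
    by (simp add: inverse_unique)
qed simp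


section \<open>Substitution as a partial ring homomorphism\<close>

text \<open>A relation instead of a function: it holds only where some fraction for
  \<open>f\<close>, reduced or not, has a denominator that survives the substitution. Away from the
  junk value of \<open>subst3\<close>, the homomorphism laws are valid.\<close>

definition maps :: "(3 \<Rightarrow> ratfun) \<Rightarrow> ratfun \<Rightarrow> ratfun \<Rightarrow> bool"
  where "maps a f g \<longleftrightarrow>
    (\<exists>p q. pol3_at q a \<noteq> 0 \<and> f = Fract p q \<and> g = pol3_at p a / pol3_at q a)"

lemma pol3_at_0 [simp]: "pol3_at 0 a = 0"
  by (simp add: pol3_at_def)

lemma pol3_at_add: "pol3_at (p + q) a = pol3_at p a + pol3_at q a"
  unfolding pol3_at_def by (simp add: map_poly_hom_add)

lemma maps_subst3: "maps a f g \<Longrightarrow> subst3 f a = g"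
  unfolding maps_def by (auto simp: subst3_Fract)

lemma maps_unique: "maps a f g \<Longrightarrow> maps a f h \<Longrightarrow> g = h"
  using maps_subst3 by metis

lemma maps_add:
  assumes "maps a f g" "maps a f' g'"
  shows "maps a (f + f') (g + g')"
proof -
  obtain p q p' q' where *: "pol3_at q a \<noteq> 0" "f = Fract p q" "g = pol3_at p a / pol3_at q a"
    "pol3_at q' a \<noteq> 0" "f' = Fract p' q'" "g' = pol3_at p' a / pol3_at q' a"
    using assms unfolding maps_def by blast
  then have "q \<noteq> 0" "q' \<noteq> 0"
    by auto
  with * show ?thesis
    unfolding maps_def
    by (intro exI[of _ "p * q' + p' * q"] exI[of _ "q * q'"])
      (simp add: pol3_at_mult pol3_at_add add_frac_eq)
qed

lemma maps_mult:
  assumes "maps a f g" "maps a f' g'"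
  shows "maps a (f * f') (g * g')"
proof -
  obtain p q p' q' where *: "pol3_at q a \<noteq> 0" "f = Fract p q" "g = pol3_at p a / pol3_at q a"
    "pol3_at q' a \<noteq> 0" "f' = Fract p' q'" "g' = pol3_at p' a / pol3_at q' a"
    using assms unfolding maps_def by blast
  then show ?thesis
    unfolding maps_def
    by (intro exI[of _ "p * p'"] exI[of _ "q * q'"]) (simp add: pol3_at_mult)
qed

lemma maps_to_fract: "maps a (to_fract p) (pol3_at p a)"
  unfolding maps_def to_fract_def
  by (intro exI[of _ p] exI[of _ 1]) (simp add: pol3_at_1)

lemma X_eq_to_fract: "\<exists>p. X i = to_fract p"
  by (auto simp: X_def)

lemma maps_X: "maps a (X i) (a i)"
  using maps_to_fract X_eq_to_fract[of i] subst3_X[of i a] maps_subst3 by metis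

lemma maps_X': "a i = g \<Longrightarrow> maps a (X i) g"
  using maps_X by metis

lemma maps_emb: "maps a (emb c) (emb c)"
  using maps_to_fract[of a "[:[:[:c:]:]:]"] subst3_emb[of c a]
  by (simp add: emb_def subst3_to_fract)

lemma maps_numeral: "maps a (numeral n) (numeral n)"
  using maps_emb[of a "numeral n"] by simp

lemma maps_0: "maps a 0 0" and maps_1: "maps a 1 1"
  using maps_emb[of a 0] maps_emb[of a 1] by simp_all

lemma maps_minus: "maps a f g \<Longrightarrow> maps a (- f) (- g)"
  using maps_mult[OF maps_emb[of a "- 1"]] by fastforce

lemma maps_diff: "maps a f g \<Longrightarrow> maps a f' g' \<Longrightarrow> maps a (f - f') (g - g')"
  using maps_add[OF _ maps_minus] by fastforce

lemma maps_power: "maps a f g \<Longrightarrow> maps a (f ^ n) (g ^ n)"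
  by (induction n) (auto intro: maps_1 maps_mult)

lemma maps_inverse:
  assumes "maps a f g" "g \<noteq> 0"
  shows "maps a (inverse f) (inverse g)"
proof -
  obtain p q where "pol3_at q a \<noteq> 0" "f = Fract p q" "g = pol3_at p a / pol3_at q a"
    using assms unfolding maps_def by blast
  with assms show ?thesis
    unfolding maps_def by (intro exI[of _ q] exI[of _ p]) auto
qed

lemma maps_divide: "maps a f g \<Longrightarrow> maps a f' g' \<Longrightarrow> g' \<noteq> 0 \<Longrightarrow> maps a (f / f') (g / g')"
  using maps_mult[OF _ maps_inverse] by (simp add: divide_inverse)

lemmas maps_intros = maps_add maps_mult maps_diff maps_power maps_divide maps_numeral maps_0 maps_1

text \<open>The coefficients of \<open>A\<close> are themselves rational functions, so they have to
  be fixed for the substitution to act on the argument alone.\<close>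

lemma maps_poly:
  assumes "\<And>n. maps a (coeff A n) (coeff A n)" "maps a t u"
  shows "maps a (poly A t) (poly A u)"
  using assms(1)
proof (induction A)
  case 0
  show ?case by (simp add: maps_0)
next
  case (pCons b A)
  have "maps a b b" "\<And>n. maps a (coeff A n) (coeff A n)"
    using pCons.prems[of 0] pCons.prems[of "Suc _"] by simp_all
  with pCons.IH assms(2) show ?case
    by (auto intro!: maps_add maps_mult)
qed

lemma maps_poly_at: "maps a t u \<Longrightarrow> maps a (poly_at p t) (poly_at p u)"
  unfolding poly_at_def by (rule maps_poly) (simp_all add: coeff_map_poly maps_emb)

text \<open>Certifies nonvanishing by evaluation, later at the point (1, 1, 1).\<close>

lemma maps_nonzero: "maps a f g \<Longrightarrow> g \<noteq> 0 \<Longrightarrow> f \<noteq> 0"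
  using maps_0 maps_unique by blast

text \<open>The junk value adds no invariants: if the reduced denominator vanishes at
  \<open>a\<close>, then \<open>subst3 f a = f\<close> forces \<open>f = 0\<close>, which is
  genuinely fixed.\<close>

lemma invariant_field_iff: "f \<in> invariant_field B \<longleftrightarrow> (\<forall>k. maps (mutation B k) f f)"
proof -
  have "maps a f f \<longleftrightarrow> subst3 f a = f" for a
  proof
    assume *: "subst3 f a = f"
    obtain p q where pq: "quot_of_fract f = (p, q)"
      by (cases "quot_of_fract f")
    then have f: "f = Fract p q"
      using quot_to_fract_quot_of_fract[of f] by (simp add: quot_to_fract_def)
    from * pq have "f = pol3_at p a / pol3_at q a"
      by (simp add: subst3_def)
    with f show "maps a f f"
      by (cases "pol3_at q a = 0") (simp_all add: maps_0, metis maps_def)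
  qed (rule maps_subst3)
  then show ?thesis
    by (simp add: invariant_field_def)
qed


section \<open>Finitely generated subrings\<close>

text \<open>The algebra over the rationals generated by \<open>E\<close>. Its fraction field is
  never formed; membership of \<open>f\<close> in it is written \<open>f * v = u\<close> with
  \<open>v \<noteq> 0\<close>.\<close>

inductive_set gen_ring :: "ratfun set \<Rightarrow> ratfun set" for E :: "ratfun set"
  where emb: "emb c \<in> gen_ring E"
  | base: "e \<in> E \<Longrightarrow> e \<in> gen_ring E"
  | add: "a \<in> gen_ring E \<Longrightarrow> b \<in> gen_ring E \<Longrightarrow> a + b \<in> gen_ring E"
  | mult: "a \<in> gen_ring E \<Longrightarrow> b \<in> gen_ring E \<Longrightarrow> a * b \<in> gen_ring E"

lemma gen_ring_numeral: "numeral n \<in> gen_ring E"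
  using gen_ring.emb[of "numeral n"] by simp

lemma gen_ring_0: "0 \<in> gen_ring E" and gen_ring_1: "1 \<in> gen_ring E"
  using gen_ring.emb[of 0] gen_ring.emb[of 1] by simp_all

lemma gen_ring_minus: "a \<in> gen_ring E \<Longrightarrow> - a \<in> gen_ring E"
  using gen_ring.mult[OF gen_ring.emb[of "- 1"]] by fastforce

lemma gen_ring_diff: "a \<in> gen_ring E \<Longrightarrow> b \<in> gen_ring E \<Longrightarrow> a - b \<in> gen_ring E"
  using gen_ring.add[OF _ gen_ring_minus] by fastforce

lemma gen_ring_power: "a \<in> gen_ring E \<Longrightarrow> a ^ n \<in> gen_ring E"
  by (induction n) (auto intro: gen_ring_1 gen_ring.mult)

lemmas gen_ring_intros = gen_ring.add gen_ring.mult gen_ring_diff gen_ring_power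
  gen_ring_numeral gen_ring_0 gen_ring_1

lemma gen_ring_poly_at: "t \<in> gen_ring E \<Longrightarrow> poly_at p t \<in> gen_ring E"
  by (induction p)
    (auto simp: poly_at_def map_poly_pCons intro: gen_ring_0 gen_ring.add gen_ring.mult gen_ring.emb)

lemma gen_ring_subset:
  assumes "a \<in> gen_ring E" "E \<subseteq> gen_ring E'"
  shows "a \<in> gen_ring E'"
  using assms by induction (auto intro: gen_ring.intros)

lemma maps_gen_ring:
  assumes "r \<in> gen_ring E" "\<And>e. e \<in> E \<Longrightarrow> maps a e e"
  shows "maps a r r"
  using assms by (induction) (auto intro: maps_emb maps_add maps_mult)

text \<open>Exposes \<open>t\<close> as the argument of a polynomial over the smaller ring, as the
  root count along an orbit requires.\<close>

lemma gen_ring_insert: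
  assumes "r \<in> gen_ring (insert t E)"
  shows "\<exists>A. (\<forall>n. coeff A n \<in> gen_ring E) \<and> r = poly A t"
  using assms
proof induction
  case (emb c)
  show ?case
    by (rule exI[of _ "[:emb c:]"]) (auto simp: coeff_pCons gen_ring.emb gen_ring_0 split: nat.split)
next
  case (base e)
  show ?case
  proof (cases "e = t")
    case True
    then show ?thesis
      by (intro exI[of _ "[:0, 1:]"])
        (auto simp: coeff_pCons gen_ring_1 gen_ring_0 split: nat.split)
  next
    case False
    with base show ?thesis
      by (intro exI[of _ "[:e:]"])
        (auto simp: coeff_pCons gen_ring.base gen_ring_0 split: nat.split)
  qed
next
  case (add a b)
  then obtain A A' where "\<forall>n. coeff A n \<in> gen_ring E" "a = poly A t"
    "\<forall>n. coeff A' n \<in> gen_ring E" "b = poly A' t"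
    by blast
  then show ?case
    by (intro exI[of _ "A + A'"]) (auto intro: gen_ring.add)
next
  case (mult a b)
  then obtain A A' where *: "\<forall>n. coeff A n \<in> gen_ring E" "a = poly A t"
    "\<forall>n. coeff A' n \<in> gen_ring E" "b = poly A' t"
    by blast
  have sum: "finite I \<Longrightarrow> (\<And>i. i \<in> I \<Longrightarrow> g i \<in> gen_ring E) \<Longrightarrow> sum g I \<in> gen_ring E"
    for g :: "nat \<Rightarrow> ratfun" and I
    by (induction I rule: finite_induct) (auto intro: gen_ring_0 gen_ring.add)
  from * show ?case
    by (intro exI[of _ "A * A'"]) (auto simp: coeff_mult intro!: sum gen_ring.mult)
qed


section \<open>The fixed field of one mutation\<close>

text \<open>The nested polynomial type is generated as an algebra by the constants and the three
  variables; this is seen layer by layer, from the innermost \<open>x\<close> outwards.\<close>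

lemma pol3_induct:
  assumes const: "\<And>c. P [:[:[:c:]:]:]"
    and var: "\<And>i v. X i = to_fract v \<Longrightarrow> P v"
    and add: "\<And>p q. P p \<Longrightarrow> P q \<Longrightarrow> P (p + q)"
    and mult: "\<And>p q. P p \<Longrightarrow> P q \<Longrightarrow> P (p * q)"
  shows "P (p :: pol3)"
proof -
  have vars: "P [:[:[:0, 1:]:]:]" "P [:[:0, 1:]:]" "P [:0, 1:]"
    using var[of 1] var[of 2] var[of 3] by (simp_all add: X_def)
  have 1: "P [:[:r:]:]" for r
  proof (induction r)
    case 0
    show ?case using const[of 0] by simp
  next
    case (pCons c r)
    have "[:[:pCons c r:]:] = [:[:[:c:]:]:] + [:[:[:0, 1:]:]:] * [:[:r:]:]"
      by simp
    then show ?case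
      using add[OF const mult[OF vars(1) pCons.IH]] by presburger
  qed
  have 2: "P [:q:]" for q
  proof (induction q)
    case 0
    show ?case using const[of 0] by simp
  next
    case (pCons r q)
    have "[:pCons r q:] = [:[:r:]:] + [:[:0, 1:]:] * [:q:]"
      by simp
    then show ?case
      using add[OF 1 mult[OF vars(2) pCons.IH]] by presburger
  qed
  show ?thesis
  proof (induction p)
    case 0
    show ?case using const[of 0] by simp
  next
    case (pCons q p)
    have "pCons q p = [:q:] + [:0, 1:] * p"
      by simp
    then show ?case
      using add[OF 2 mult[OF vars(3) pCons.IH]] by presburger
  qed
qed

text \<open>
  The field of rational functions is quadratic over the field generated by the other two variables
  and the trace and norm of \<open>X i\<close>; the substitution acts on it as the conjugation.
\<close>

lemma fixed_by_involution:
  assumes "maps a f f" and "a i \<noteq> X i"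
    and trace: "X i + a i \<in> gen_ring E" and norm: "X i * a i \<in> gen_ring E"
    and others: "\<And>j. j \<noteq> i \<Longrightarrow> a j = X j \<and> X j \<in> gen_ring E"
  shows "\<exists>u v. u \<in> gen_ring E \<and> v \<in> gen_ring E \<and> v \<noteq> 0 \<and> f * v = u"
proof -
  have split: "\<exists>u\<in>gen_ring E. \<exists>v\<in>gen_ring E.
    to_fract p = u + v * X i \<and> pol3_at p a = u + v * a i" for p
  proof (induction p rule: pol3_induct)
    case (1 c)
    have "pol3_at [:[:[:c:]:]:] a = emb c"
      using subst3_emb[of c a] by (simp add: emb_def subst3_to_fract)
    then show ?case
      by (rule_tac bexI[of _ "emb c"], rule_tac bexI[of _ 0]) (auto simp: emb_def[symmetric] gen_ring_0 gen_ring.emb)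
  next
    case (2 j v)
    then have *: "pol3_at v a = a j"
      using subst3_X[of j a] by (simp add: subst3_to_fract)
    show ?case
    proof (cases "j = i")
      case True
      with 2 * show ?thesis
        by (rule_tac bexI[of _ 0], rule_tac bexI[of _ 1]) (auto simp: gen_ring_0 gen_ring_1)
    next
      case False
      with 2 * others[of j] show ?thesis
        by (rule_tac bexI[of _ "X j"], rule_tac bexI[of _ 0]) (auto simp: gen_ring_0)
    qed
  next
    case (3 p q)
    then obtain u v u' v' where *: "u \<in> gen_ring E" "v \<in> gen_ring E"
      "u' \<in> gen_ring E" "v' \<in> gen_ring E"
      "to_fract p = u + v * X i" "pol3_at p a = u + v * a i"
      "to_fract q = u' + v' * X i" "pol3_at q a = u' + v' * a i"
      by blast
    then show ?case
      by (rule_tac bexI[of _ "u + u'"], rule_tac bexI[of _ "v + v'"])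
        (auto simp: pol3_at_add distrib_right add_ac intro: gen_ring.add)
  next
    case (4 p q)
    then obtain u v u' v' where *: "u \<in> gen_ring E" "v \<in> gen_ring E"
      "u' \<in> gen_ring E" "v' \<in> gen_ring E"
      "to_fract p = u + v * X i" "pol3_at p a = u + v * a i"
      "to_fract q = u' + v' * X i" "pol3_at q a = u' + v' * a i"
      by blast
    \<comment> \<open>The relation \<open>t^2 = (X i + a i) * t - X i * a i\<close> holds for
      \<open>t = X i\<close> and for \<open>t = a i\<close>, so the same reduced coefficients serve
      both.\<close>
    have "u * u' - v * v' * (X i * a i) \<in> gen_ring E"
      "u * v' + v * u' + v * v' * (X i + a i) \<in> gen_ring E"
      by (intro trace norm *(1-4) gen_ring_diff gen_ring.add gen_ring.mult)+
    moreover have "to_fract (p * q) =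
        (u * u' - v * v' * (X i * a i)) + (u * v' + v * u' + v * v' * (X i + a i)) * X i"
      unfolding to_fract_mult *(5,7) by (simp add: algebra_simps)
    moreover have "pol3_at (p * q) a =
        (u * u' - v * v' * (X i * a i)) + (u * v' + v * u' + v * v' * (X i + a i)) * a i"
      unfolding pol3_at_mult *(6,8) by (simp add: algebra_simps)
    ultimately show ?case
      by blast
  qed
  obtain p q where pq: "pol3_at q a \<noteq> 0" "f = Fract p q" "f = pol3_at p a / pol3_at q a"
    using assms(1) unfolding maps_def by blast
  then have "q \<noteq> 0"
    by auto
  obtain u v where uv: "u \<in> gen_ring E" "v \<in> gen_ring E"
    "to_fract p = u + v * X i" "pol3_at p a = u + v * a i"
    using split by blast
  obtain c d where cd: "c \<in> gen_ring E" "d \<in> gen_ring E"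
    "to_fract q = c + d * X i" "pol3_at q a = c + d * a i"
    using split by blast
  have 1: "f * (c + d * X i) = u + v * X i"
    using pq(2) \<open>q \<noteq> 0\<close> uv cd by (metis Fract_conv_to_fract nonzero_eq_divide_eq to_fract_eq_0_iff)
  have 2: "f * (c + d * a i) = u + v * a i"
    using pq uv cd by (metis nonzero_eq_divide_eq)
  \<comment> \<open>Subtracting the conjugate equation 2 from 1 isolates the coefficient of
    \<open>X i - a i\<close>, which is nonzero.\<close>
  have "(f * d - v) * (X i - a i) =
      (f * (c + d * X i) - (u + v * X i)) - (f * (c + d * a i) - (u + v * a i))"
    by (simp add: algebra_simps)
  also have "\<dots> = 0"
    using 1 2 by simp
  finally have "(f * d - v) * (X i - a i) = 0" .
  with assms(2) have fd: "f * d = v"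
    by simp
  have "f * c = f * (c + d * X i) - f * d * X i"
    by (simp add: algebra_simps)
  with 1 fd have fc: "f * c = u"
    by simp
  show ?thesis
  \<comment> \<open>As \<open>q\<close> is nonzero, \<open>c\<close> or \<open>d\<close> is nonzero
    and can serve as the denominator.\<close>
  proof (cases "d = 0")
    case True
    then have "c \<noteq> 0"
      using cd \<open>q \<noteq> 0\<close> by (metis add.right_neutral mult_zero_left to_fract_eq_0_iff)
    with fc uv cd show ?thesis by blast
  next
    case False
    with fd uv cd show ?thesis by blast
  qed
qed


section \<open>Quotients fixed by an infinite orbit\<close>

text \<open>First coordinate of a pair after \<open>n\<close> rounds, each reflecting
  \<open>p\<close> and then \<open>q\<close>. The recursion advances the starting pair, so a
  substitution acting on \<open>p\<close> and \<open>q\<close> passes through the whole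
  expression.\<close>

primrec orbit :: "'a::comm_ring_1 \<Rightarrow> 'a \<Rightarrow> 'a \<Rightarrow> 'a \<Rightarrow> nat \<Rightarrow> 'a"
  where "orbit s\<^sub>1 s\<^sub>2 p q 0 = p"
  | "orbit s\<^sub>1 s\<^sub>2 p q (Suc n) = orbit s\<^sub>1 s\<^sub>2 (s\<^sub>1 * q - p) (s\<^sub>2 * (s\<^sub>1 * q - p) - q) n"

lemma maps_orbit:
  assumes "maps a s\<^sub>1 t\<^sub>1" "maps a s\<^sub>2 t\<^sub>2" "maps a p p'" "maps a q q'"
  shows "maps a (orbit s\<^sub>1 s\<^sub>2 p q n) (orbit t\<^sub>1 t\<^sub>2 p' q' n)"
  using assms(3,4)
proof (induction n arbitrary: p q p' q')
  case (Suc n)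
  show ?case
    unfolding orbit.simps by (intro Suc.IH maps_diff maps_mult assms(1,2) Suc.prems)
qed simp

lemma emb_orbit: "emb (orbit s\<^sub>1 s\<^sub>2 p q n) = orbit (emb s\<^sub>1) (emb s\<^sub>2) (emb p) (emb q) n"
  by (induction n arbitrary: p q) simp_all

text \<open>Since \<open>p + p' = s\<^sub>1 * q\<close>, the last hypothesis says that the
  reflection increases \<open>p\<close>. One round is linear with determinant 1 and trace
  \<open>s\<^sub>1 * s\<^sub>2 - 2\<close>; the bound makes this at least 2, and then the inequality
  passes to the next pair.\<close>

lemma orbit_step_ineq:
  fixes s\<^sub>1 s\<^sub>2 p q :: rat
  assumes "s\<^sub>1 > 0" "s\<^sub>2 > 0" "s\<^sub>1 * s\<^sub>2 \<ge> 4" "q > 0" "2 * p < s\<^sub>1 * q"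
  defines "p' \<equiv> s\<^sub>1 * q - p"
  defines "q' \<equiv> s\<^sub>2 * p' - q"
  shows "p < p'" "q' > 0" "2 * p' < s\<^sub>1 * q'"
proof -
  show "p < p'"
    using assms(5) unfolding p'_def by linarith
  have 1: "2 * p' > s\<^sub>1 * q"
    using assms(5) unfolding p'_def by (simp add: algebra_simps)
  then have "s\<^sub>2 * (2 * p') > s\<^sub>2 * (s\<^sub>1 * q)"
    using assms by simp
  moreover have "s\<^sub>1 * s\<^sub>2 * q \<ge> 4 * q"
    using assms by simp
  ultimately have 2: "s\<^sub>2 * p' > 2 * q"
    by (simp add: mult_ac)
  then show "q' > 0"
    using assms by simp
  from 2 have "2 * q' > s\<^sub>2 * p'"
    unfolding q'_def by (simp add: algebra_simps)
  then have "s\<^sub>1 * (2 * q') > s\<^sub>1 * (s\<^sub>2 * p')"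
    using assms(1) by simp
  moreover have "0 < p'"
    using 1 mult_pos_pos[OF assms(1,4)] by linarith
  then have "s\<^sub>1 * s\<^sub>2 * p' \<ge> 4 * p'"
    using assms(3) by simp
  ultimately show "2 * p' < s\<^sub>1 * q'"
    by (simp add: mult_ac)
qed

lemma orbit_strict_mono:
  fixes s\<^sub>1 s\<^sub>2 p q :: rat
  assumes s: "s\<^sub>1 > 0" "s\<^sub>2 > 0" "s\<^sub>1 * s\<^sub>2 \<ge> 4" and "q > 0" "2 * p < s\<^sub>1 * q"
  shows "strict_mono (orbit s\<^sub>1 s\<^sub>2 p q)"
proof -
  have "orbit s\<^sub>1 s\<^sub>2 p q n < orbit s\<^sub>1 s\<^sub>2 p q (Suc n)" for n
    using assms(4,5)
  proof (induction n arbitrary: p q)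
    case 0
    then show ?case
      using orbit_step_ineq(1)[OF s] by simp
  next
    case (Suc n)
    show ?case
      using Suc.IH[OF orbit_step_ineq(2,3)[OF s Suc.prems]] by simp
  qed
  then show ?thesis
    by (simp add: strict_mono_Suc_iff)
qed

text \<open>
  The two substitutions together move \<open>p\<close> through an infinite orbit, seen to be infinite by
  evaluating at the rational point \<open>o\<close>. If \<open>f = A(p) / B(p)\<close> is invariant, then \<open>A - f B\<close> vanishes
  on the orbit, so it is the zero polynomial and \<open>f\<close> is a quotient of coefficients.
\<close>

lemma fixed_by_orbit:
  assumes mu: "maps \<mu> p (s\<^sub>1 * q - p)" "maps \<mu> q q" "maps \<mu> s\<^sub>1 s\<^sub>1" "maps \<mu> s\<^sub>2 s\<^sub>2" "maps \<mu> f f"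
    and nu: "maps \<nu> p p" "maps \<nu> q (s\<^sub>2 * p - q)" "maps \<nu> s\<^sub>1 s\<^sub>1" "maps \<nu> s\<^sub>2 s\<^sub>2" "maps \<nu> f f"
    and E: "\<And>e. e \<in> E \<Longrightarrow> maps \<mu> e e" "\<And>e. e \<in> E \<Longrightarrow> maps \<nu> e e"
    and pt: "maps \<epsilon> p (emb p\<^sub>0)" "maps \<epsilon> q (emb q\<^sub>0)" "maps \<epsilon> s\<^sub>1 (emb t\<^sub>1)" "maps \<epsilon> s\<^sub>2 (emb t\<^sub>2)"
    and ineq: "t\<^sub>1 > 0" "t\<^sub>2 > 0" "t\<^sub>1 * t\<^sub>2 \<ge> 4" "q\<^sub>0 > 0" "2 * p\<^sub>0 < t\<^sub>1 * q\<^sub>0"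
    and quot: "u \<in> gen_ring (insert p E)" "v \<in> gen_ring (insert p E)" "v \<noteq> 0" "f * v = u"
  shows "\<exists>u v. u \<in> gen_ring E \<and> v \<in> gen_ring E \<and> v \<noteq> 0 \<and> f * v = u"
proof -
  obtain A B where A: "\<And>n. coeff A n \<in> gen_ring E" "u = poly A p"
    and B: "\<And>n. coeff B n \<in> gen_ring E" "v = poly B p"
    using gen_ring_insert quot(1,2) by metis
  define D where "D = A - smult f B"
  have coeffs: "maps \<mu> (coeff D n) (coeff D n)" "maps \<nu> (coeff D n) (coeff D n)" for n
    unfolding D_def
    unfolding coeff_diff coeff_smult
    by (intro maps_diff maps_mult mu(5) nu(5) maps_gen_ring[OF A(1)] maps_gen_ring[OF B(1)] E; assumption)+
  have root: "poly D (orbit s\<^sub>1 s\<^sub>2 p q n) = 0" for n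
  proof (induction n)
    case 0
    then show ?case
      using quot(4) A B by (simp add: D_def)
  next
    case (Suc n)
    \<comment> \<open>Applying \<open>\<nu>\<close> first and \<open>\<mu>\<close> second carries
      \<open>(p, q)\<close> to the pair after one round; both fix the coefficients of
      \<open>D\<close>, so a root goes to a root.\<close>
    have "maps \<nu> (poly D (orbit s\<^sub>1 s\<^sub>2 p q n)) (poly D (orbit s\<^sub>1 s\<^sub>2 p (s\<^sub>2 * p - q) n))"
      by (intro maps_poly coeffs maps_orbit nu)
    then have "poly D (orbit s\<^sub>1 s\<^sub>2 p (s\<^sub>2 * p - q) n) = 0"
      using Suc.IH maps_0 maps_unique by metis
    moreover have "maps \<mu> (poly D (orbit s\<^sub>1 s\<^sub>2 p (s\<^sub>2 * p - q) n)) (poly D (orbit s\<^sub>1 s\<^sub>2 p q (Suc n)))"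
      unfolding orbit.simps by (intro maps_poly coeffs maps_orbit mu maps_diff maps_mult)
    ultimately show ?case
      using maps_0 maps_unique by metis
  qed
  have "inj (orbit s\<^sub>1 s\<^sub>2 p q)"
  proof (rule injI)
    fix m n
    assume "orbit s\<^sub>1 s\<^sub>2 p q m = orbit s\<^sub>1 s\<^sub>2 p q n"
    moreover have "maps \<epsilon> (orbit s\<^sub>1 s\<^sub>2 p q k) (emb (orbit t\<^sub>1 t\<^sub>2 p\<^sub>0 q\<^sub>0 k))" for k
      unfolding emb_orbit by (intro maps_orbit pt)
    ultimately have "orbit t\<^sub>1 t\<^sub>2 p\<^sub>0 q\<^sub>0 m = orbit t\<^sub>1 t\<^sub>2 p\<^sub>0 q\<^sub>0 n"
      using maps_unique emb_eq_iff by metis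
    then show "m = n"
      using orbit_strict_mono[OF ineq] by (simp add: strict_mono_eq)
  qed
  then have "infinite (range (orbit s\<^sub>1 s\<^sub>2 p q))"
    by (rule range_inj_infinite)
  moreover have "range (orbit s\<^sub>1 s\<^sub>2 p q) \<subseteq> {t. poly D t = 0}"
    using root by auto
  ultimately have "infinite {t. poly D t = 0}"
    using infinite_super by metis
  then have "D = 0"
    using poly_roots_finite by blast
  then have "f * coeff B n = coeff A n" for n
    unfolding D_def by (metis coeff_smult eq_iff_diff_eq_0)
  moreover obtain n where "coeff B n \<noteq> 0"
    using quot(3) B(2) by (metis leading_coeff_0_iff poly_0)
  ultimately show ?thesis
    using A B by blast
qed


section \<open>The field and the ring generated by one element\<close>

lemma poly_at_pCons: "poly_at (pCons c p) t = emb c + t * poly_at p t"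
  by (simp add: poly_at_def map_poly_pCons)

lemma poly_at_const: "poly_at [:c:] t = emb c"
  by (simp add: poly_at_pCons)

lemma poly_at_1: "poly_at 1 t = 1"
  using poly_at_const[of 1 t] by (simp add: one_pCons)

lemma poly_at_monom: "poly_at (monom c n) t = emb c * t ^ n"
  by (simp add: poly_at_def map_poly_monom poly_monom)

lemma poly_at_in_field: "poly_at p t \<in> ratfun_field_of t"
  unfolding ratfun_field_of_def by (intro CollectI exI[of _ p] exI[of _ 1]) (simp add: poly_at_1)

lemma ratfun_field_of_divide:
  assumes "f \<in> ratfun_field_of t" "g \<in> ratfun_field_of t" "g \<noteq> 0"
  shows "f / g \<in> ratfun_field_of t"
proof -
  obtain p q p' q' where "f = poly_at p t / poly_at q t" "poly_at q t \<noteq> 0"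
    "g = poly_at p' t / poly_at q' t" "poly_at q' t \<noteq> 0"
    using assms unfolding ratfun_field_of_def by blast
  with assms(3) show ?thesis
    unfolding ratfun_field_of_def
    by (intro CollectI exI[of _ "p * q'"] exI[of _ "q * p'"]) auto
qed

text \<open>The inverse is among the generators because in the case of \<open>B2\<close> the
  variable \<open>x\<close> is recovered from \<open>w\<close> and \<open>T\<close> only after
  division by \<open>T\<close>.\<close>

lemma gen_ring_subset_field: "r \<in> gen_ring {t, inverse t} \<Longrightarrow> r \<in> ratfun_field_of t"
proof (induction rule: gen_ring.induct)
  case (emb c)
  show ?case
    using poly_at_in_field[of "[:c:]" t] by (simp add: poly_at_const)
next
  case (base e)
  have t: "t \<in> ratfun_field_of t" and 1: "1 \<in> ratfun_field_of t" and 0: "0 \<in> ratfun_field_of t"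
    using poly_at_in_field[of "[:0, 1:]" t] poly_at_in_field[of 1 t] poly_at_in_field[of 0 t]
    by (simp_all add: poly_at_pCons poly_at_1)
  show ?case
    \<comment> \<open>For \<open>t = 0\<close> the inverse is 0 by convention and still lies in the
      field.\<close>
    using base t 0 ratfun_field_of_divide[OF 1 t] by (cases "t = 0") (auto simp: divide_inverse)
next
  case (add a b)
  then obtain p q p' q' where "a = poly_at p t / poly_at q t" "poly_at q t \<noteq> 0"
    "b = poly_at p' t / poly_at q' t" "poly_at q' t \<noteq> 0"
    unfolding ratfun_field_of_def by blast
  then show ?case
    unfolding ratfun_field_of_def
    by (intro CollectI exI[of _ "p * q' + p' * q"] exI[of _ "q * q'"]) (simp add: add_frac_eq)
next
  case (mult a b)
  then obtain p q p' q' where "a = poly_at p t / poly_at q t" "poly_at q t \<noteq> 0"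
    "b = poly_at p' t / poly_at q' t" "poly_at q' t \<noteq> 0"
    unfolding ratfun_field_of_def by blast
  then show ?case
    unfolding ratfun_field_of_def
    by (intro CollectI exI[of _ "p * p'"] exI[of _ "q * q'"]) simp
qed

lemma maps_ratfun_field_of:
  assumes "maps a t t" "f \<in> ratfun_field_of t"
  shows "maps a f f"
proof -
  obtain p q where "f = poly_at p t / poly_at q t" "poly_at q t \<noteq> 0"
    using assms(2) unfolding ratfun_field_of_def by blast
  then show ?thesis
    using assms(1) by (auto intro!: maps_divide maps_poly_at)
qed


section \<open>Laurent polynomials\<close>

lemma laurent_ringI: "finite S \<Longrightarrow> (\<Sum>e\<in>S. emb (c e) * laurent_monom e) \<in> laurent_ring"
  unfolding laurent_ring_def by blast

lemma laurent_ring_term: "emb c * laurent_monom e \<in> laurent_ring"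
  using laurent_ringI[of "{e}" "\<lambda>_. c"] by simp

lemma laurent_ring_add:
  assumes "f \<in> laurent_ring" "g \<in> laurent_ring"
  shows "f + g \<in> laurent_ring"
proof -
  obtain S c S' c' where *: "finite S" "f = (\<Sum>e\<in>S. emb (c e) * laurent_monom e)"
    "finite S'" "g = (\<Sum>e\<in>S'. emb (c' e) * laurent_monom e)"
    using assms unfolding laurent_ring_def by blast
  have "f = (\<Sum>e\<in>S \<union> S'. emb (if e \<in> S then c e else 0) * laurent_monom e)"
    unfolding *(2) using *(1,3) by (intro sum.mono_neutral_cong_left) auto
  moreover have "g = (\<Sum>e\<in>S \<union> S'. emb (if e \<in> S' then c' e else 0) * laurent_monom e)"
    unfolding *(4) using *(1,3) by (intro sum.mono_neutral_cong_left) auto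
  ultimately have eq: "f + g = (\<Sum>e\<in>S \<union> S'. emb ((if e \<in> S then c e else 0) +
      (if e \<in> S' then c' e else 0)) * laurent_monom e)"
    by (simp add: sum.distrib distrib_right)
  show ?thesis
    unfolding eq using *(1,3) by (intro laurent_ringI finite_UnI)
qed

lemma laurent_ring_sum: "finite I \<Longrightarrow> (\<And>i. i \<in> I \<Longrightarrow> g i \<in> laurent_ring) \<Longrightarrow> sum g I \<in> laurent_ring"
proof (induction I rule: finite_induct)
  case empty
  show ?case
    using laurent_ringI[of "{}"] by simp
qed (auto intro: laurent_ring_add)

lemma X_nonzero [simp]: "X i \<noteq> 0"
  by (simp add: X_def)

lemma laurent_monom_add: "laurent_monom e * laurent_monom e' = laurent_monom (\<lambda>i. e i + e' i)"
  unfolding laurent_monom_def by (simp add: power_int_add prod.distrib)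

lemma laurent_ring_mult:
  assumes "f \<in> laurent_ring" "g \<in> laurent_ring"
  shows "f * g \<in> laurent_ring"
proof -
  obtain S c S' c' where *: "finite S" "f = (\<Sum>e\<in>S. emb (c e) * laurent_monom e)"
    "finite S'" "g = (\<Sum>e\<in>S'. emb (c' e) * laurent_monom e)"
    using assms unfolding laurent_ring_def by blast
  have eq: "f * g = (\<Sum>e\<in>S. \<Sum>e'\<in>S'. emb (c e * c' e') * laurent_monom (\<lambda>i. e i + e' i))"
    unfolding *(2,4) sum_product laurent_monom_add[symmetric] by (simp add: mult_ac)
  show ?thesis
    unfolding eq using *(1,3) by (intro laurent_ring_sum laurent_ring_term)
qed

lemma laurent_monom_single: "laurent_monom (\<lambda>j. if j = i then k else 0) = X i powi k"
proof -
  have "laurent_monom (\<lambda>j. if j = i then k else 0) = (\<Prod>j\<in>UNIV. if j = i then X i powi k else 1)"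
    unfolding laurent_monom_def by (rule prod.cong) auto
  then show ?thesis
    by (simp add: prod.delta)
qed

text \<open>Replaces sums of monomials by generators, so that closure properties and induction come
  from \<open>gen_ring\<close>.\<close>

lemma laurent_ring_eq: "laurent_ring = gen_ring (range X \<union> range (\<lambda>i. inverse (X i)))"
  (is "_ = gen_ring ?V")
proof (intro set_eqI iffI)
  fix f
  assume "f \<in> gen_ring ?V"
  then show "f \<in> laurent_ring"
  proof induction
    case (emb c)
    have "laurent_monom (\<lambda>_. 0) = 1"
      by (simp add: laurent_monom_def)
    then show ?case
      using laurent_ring_term[of c "\<lambda>_. 0"] by simp
  next
    case (base e)
    have "X i powi k \<in> laurent_ring" for i k
      using laurent_ring_term[of 1 "\<lambda>j. if j = i then k else 0"] by (simp add: laurent_monom_single)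
    from this[of _ 1] this[of _ "- 1"] base show ?case
      by auto
  qed (auto intro: laurent_ring_add laurent_ring_mult)
next
  fix f
  assume "f \<in> laurent_ring"
  then obtain S c where *: "finite S" "f = (\<Sum>e\<in>S. emb (c e) * laurent_monom e)"
    unfolding laurent_ring_def by blast
  have sum: "finite I \<Longrightarrow> (\<And>i. i \<in> I \<Longrightarrow> g i \<in> gen_ring ?V) \<Longrightarrow> sum g I \<in> gen_ring ?V"
    for g :: "(3 \<Rightarrow> int) \<Rightarrow> ratfun" and I
    by (induction I rule: finite_induct) (auto intro: gen_ring_0 gen_ring.add)
  have "X i \<in> gen_ring ?V" "inverse (X i) \<in> gen_ring ?V" for i
    by (auto intro!: gen_ring.base)
  then have powi: "X i powi k \<in> gen_ring ?V" for i k
    by (simp add: power_int_def gen_ring_power)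
  have "laurent_monom e \<in> gen_ring ?V" for e
    unfolding laurent_monom_def prod_UNIV_3 by (intro gen_ring.mult powi)
  then show "f \<in> gen_ring ?V"
    unfolding *(2) by (intro sum *(1) gen_ring.mult gen_ring.emb)
qed

text \<open>Shows that \<open>X 1\<close> is transcendental: an identity between values at
  \<open>X 1\<close> is an identity of polynomials.\<close>

lemma poly_at_X1: "poly_at p (X 1) = to_fract [:[:p:]:]"
proof (induction p)
  case (pCons c p)
  have "[:[:pCons c p:]:] = [:[:[:c:]:]:] + [:[:[:0, 1:]:]:] * ([:[:p:]:] :: pol3)"
    by simp
  then have "to_fract [:[:pCons c p:]:] = emb c + X 1 * (to_fract [:[:p:]:] :: ratfun)"
    unfolding emb_def X_def by (simp only: to_fract_add to_fract_mult simp_thms if_True)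
  with pCons show ?case
    by (simp add: poly_at_pCons)
qed simp

lemma gen_ring_Laurent_1:
  assumes "r \<in> gen_ring {t, inverse t}" "t \<noteq> 0"
  shows "\<exists>q m. r * t ^ m = poly_at q t"
  using assms(1)
proof induction
  case (emb c)
  show ?case
    by (intro exI[of _ "[:c:]"] exI[of _ 0]) (simp add: poly_at_const)
next
  case (base e)
  then consider "e = t" | "e = inverse t"
    by blast
  then show ?case
  proof cases
    case 1
    then show ?thesis
      by (intro exI[of _ "[:0, 1:]"] exI[of _ 0]) (simp add: poly_at_pCons)
  next
    case 2
    with assms(2) show ?thesis
      by (intro exI[of _ 1] exI[of _ 1]) (simp add: poly_at_1)
  qed
next
  case (add a b)
  then obtain q m q' m' where *: "a * t ^ m = poly_at q t" "b * t ^ m' = poly_at q' t"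
    by blast
  have "(a + b) * t ^ (m + m') = (a * t ^ m) * t ^ m' + (b * t ^ m') * t ^ m"
    by (simp add: power_add algebra_simps)
  also have "\<dots> = poly_at (q * monom 1 m' + q' * monom 1 m) t"
    by (simp add: * poly_at_monom)
  finally show ?case by blast
next
  case (mult a b)
  then obtain q m q' m' where *: "a * t ^ m = poly_at q t" "b * t ^ m' = poly_at q' t"
    by blast
  have "(a * b) * t ^ (m + m') = (a * t ^ m) * (b * t ^ m')"
    by (simp add: power_add algebra_simps)
  also have "\<dots> = poly_at (q * q') t"
    by (simp add: *)
  finally show ?case by blast
qed

text \<open>The indeterminate does not divide \<open>p\<close>, so it divides \<open>q\<close> and
  can be cancelled until \<open>p\<close> divides 1.\<close>

lemma degree_divisor_of_monom:
  fixes p q :: "rat poly"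
  assumes "p * q = monom 1 k" "coeff p 0 \<noteq> 0"
  shows "degree p = 0"
  using assms(1)
proof (induction k arbitrary: q)
  case 0
  then have "p * q = 1"
    by (simp add: monom_0)
  then show ?case
    by (metis dvdI is_unit_polyE degree_pCons_0)
next
  case (Suc k)
  then have "coeff p 0 * coeff q 0 = 0"
    by (metis coeff_monom coeff_mult_0 nat.distinct(1))
  then obtain q' where q: "q = pCons 0 q'"
    using assms(2) by (cases q) auto
  with Suc.prems have "p * q' = monom 1 k"
    by (simp add: monom_Suc)
  then show ?case
    by (rule Suc.IH)
qed

text \<open>The degree and the constant term of \<open>C\<close> record that
  \<open>B(n(t) / t)\<close> has a pole of order \<open>degree B\<close> both at infinity and at
  0.\<close>

lemma clear_denominators:
  assumes "B \<noteq> 0" "t \<noteq> 0" "degree n = 2" "coeff n 0 \<noteq> 0"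
  shows "\<exists>C. poly_at B (poly_at n t / t) * t ^ degree B = poly_at C t \<and>
    degree C = 2 * degree B \<and> coeff C 0 \<noteq> 0"
  using assms(1)
proof (induction B)
  case (pCons b B)
  show ?case
  proof (cases "B = 0")
    case True
    with pCons show ?thesis
      by (intro exI[of _ "[:b:]"]) (simp add: poly_at_const)
  next
    case False
    then obtain C where C: "poly_at B (poly_at n t / t) * t ^ degree B = poly_at C t"
      "degree C = 2 * degree B" "coeff C 0 \<noteq> 0"
      using pCons by blast
    let ?d = "Suc (degree B)"
    have "C \<noteq> 0" "n \<noteq> 0"
      using C(3) assms(4) by auto
    then have deg: "degree (n * C) = 2 * ?d"
      using C(2) assms(3) by (simp add: degree_mult_eq)
    \<comment> \<open>Horner step: the new monomial has degree strictly between 0 and that of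
      \<open>n * C\<close>, so the constant and leading terms are undisturbed.\<close>
    have "degree (monom b ?d) < degree (n * C)"
      unfolding deg by (rule le_less_trans[OF degree_monom_le]) simp
    then have "degree (monom b ?d + n * C) = 2 * ?d"
      using deg by (simp add: degree_add_eq_right)
    moreover have "coeff (monom b ?d + n * C) 0 \<noteq> 0"
      using C(3) assms(4) by (simp add: coeff_mult_0)
    moreover have "poly_at (pCons b B) (poly_at n t / t) * t ^ ?d =
      emb b * t ^ ?d + poly_at n t * (poly_at B (poly_at n t / t) * t ^ degree B)"
      using assms(2) by (simp add: poly_at_pCons algebra_simps)
    then have "poly_at (pCons b B) (poly_at n t / t) * t ^ ?d = poly_at (monom b ?d + n * C) t"
      unfolding C(1) by (simp add: poly_at_monom)
    ultimately show ?thesis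
      using False by (intro exI[of _ "monom b ?d + n * C"]) simp
  qed
qed simp

text \<open>
  For coprime \<open>A\<close> and \<open>B\<close>, the element \<open>B(T)\<close> is a unit of the Laurent ring if \<open>A(T) / B(T)\<close> is a
  Laurent polynomial. Setting two of the variables to 1 makes \<open>T\<close> a Laurent polynomial in one
  variable \<open>t\<close> with a pole both at 0 and at infinity, so \<open>B(T)\<close> can only be a monomial in \<open>t\<close> if
  \<open>B\<close> is constant.
\<close>

lemma laurent_imp_poly_ring:
  assumes f: "f \<in> ratfun_field_of T" "f \<in> laurent_ring" and T: "T \<in> laurent_ring"
    and \<rho>: "\<And>i. \<rho> i = X 1 \<or> \<rho> i = 1"
    and \<rho>T: "maps \<rho> T (poly_at n (X 1) / X 1)" and n: "degree n = 2" "coeff n 0 \<noteq> 0"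
  shows "f \<in> poly_ring_of T"
proof -
  obtain A B where AB: "f = poly_at A T / poly_at B T" "poly_at B T \<noteq> 0"
    using f(1) unfolding ratfun_field_of_def by blast
  obtain A' B' where A': "A = gcd A B * A'" and B': "B = gcd A B * B'"
    by (meson dvdE gcd_dvd1 gcd_dvd2)
  let ?u = "fst (bezout_coefficients A B)" and ?v = "snd (bezout_coefficients A B)"
  have "B \<noteq> 0"
    using AB by auto
  have "gcd A B * (?u * A' + ?v * B') = ?u * (gcd A B * A') + ?v * (gcd A B * B')"
    by (simp add: algebra_simps)
  also have "\<dots> = gcd A B"
    unfolding A'[symmetric] B'[symmetric] by (rule bezout_coefficients_fst_snd)
  finally have bezout: "?u * A' + ?v * B' = 1"
    using \<open>B \<noteq> 0\<close> by simp
  have split: "poly_at A T = poly_at (gcd A B) T * poly_at A' T"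
    "poly_at B T = poly_at (gcd A B) T * poly_at B' T"
    using A' B' poly_at_simps(3) by metis+
  with AB have B'_nz: "poly_at B' T \<noteq> 0" and f_eq: "f = poly_at A' T / poly_at B' T"
    by auto
  have "B' \<noteq> 0"
    using B'_nz by auto
  \<comment> \<open>By Bezout this is the inverse of \<open>B'(T)\<close>, written as a polynomial
    combination of \<open>f\<close> and \<open>T\<close> and therefore Laurent.\<close>
  define l where "l = poly_at ?u T * f + poly_at ?v T"
  have "poly_at B' T * l = poly_at (?u * A' + ?v * B') T"
    using B'_nz unfolding l_def f_eq by (simp add: field_simps)
  then have unit: "poly_at B' T * l = 1"
    unfolding bezout by (simp add: poly_at_1)
  have "l \<in> laurent_ring"
    using f(2) T unfolding l_def laurent_ring_eq
    by (intro gen_ring.add gen_ring.mult gen_ring_poly_at)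
  \<comment> \<open>Every variable goes to \<open>X 1\<close> or 1, both invertible, so the
    specialization is defined on the whole Laurent ring.\<close>
  then obtain l' where l': "maps \<rho> l l'" "l' \<in> gen_ring {X 1, inverse (X 1)}"
  proof -
    assume "l \<in> laurent_ring" and that: "\<And>l'. maps \<rho> l l' \<Longrightarrow> l' \<in> gen_ring {X 1, inverse (X 1)} \<Longrightarrow> thesis"
    then have "\<exists>l'. maps \<rho> l l' \<and> l' \<in> gen_ring {X 1, inverse (X 1)}"
      unfolding laurent_ring_eq
    proof induction
      case (base e)
      then obtain i where e: "e = X i \<or> e = inverse (X i)"
        by blast
      have nz: "\<rho> i \<noteq> 0"
        using \<rho>[of i] by auto
      have "\<rho> i \<in> gen_ring {X 1, inverse (X 1)}" "inverse (\<rho> i) \<in> gen_ring {X 1, inverse (X 1)}"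
        using \<rho>[of i] by (auto simp: gen_ring_1 intro: gen_ring.base)
      with e maps_X[of \<rho> i] maps_inverse[OF maps_X[of \<rho> i] nz] show ?case
        by blast
    qed (blast intro: maps_emb maps_add maps_mult gen_ring.intros)+
    with that show thesis
      by blast
  qed
  let ?t = "X 1"
  have "maps \<rho> (poly_at B' T * l) (poly_at B' (poly_at n ?t / ?t) * l')"
    by (intro maps_mult maps_poly_at \<rho>T l')
  then have unit': "poly_at B' (poly_at n ?t / ?t) * l' = 1"
    unfolding unit using maps_1 maps_unique by metis
  obtain C where C: "poly_at B' (poly_at n ?t / ?t) * ?t ^ degree B' = poly_at C ?t"
    "degree C = 2 * degree B'" "coeff C 0 \<noteq> 0"
    using clear_denominators[OF \<open>B' \<noteq> 0\<close> _ n, of ?t] by auto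
  obtain q m where q: "l' * ?t ^ m = poly_at q ?t"
    using gen_ring_Laurent_1[OF l'(2)] by auto
  have "poly_at (C * q) ?t = (poly_at B' (poly_at n ?t / ?t) * l') * (?t ^ degree B' * ?t ^ m)"
    unfolding poly_at_simps C(1)[symmetric] q[symmetric] by (simp only: mult_ac)
  also have "\<dots> = poly_at (monom 1 (degree B' + m)) ?t"
    unfolding unit' by (simp add: poly_at_monom power_add)
  finally have "C * q = monom 1 (degree B' + m)"
    by (simp add: poly_at_X1)
  then have "degree C = 0"
    using degree_divisor_of_monom C(3) by blast
  with C(2) obtain b where b: "B' = [:b:]"
    by (metis degree_eq_zeroE mult_eq_0_iff zero_neq_numeral)
  with f_eq have "f = poly_at (A' * [:inverse b:]) T"
    by (simp only: poly_at_simps(3) poly_at_const divide_inverse emb_inverse)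
  then show ?thesis
    unfolding poly_ring_of_def by blast
qed


section \<open>Invariant rational functions\<close>

text \<open>
  Invariance under \<open>a\<^sub>2\<close> and \<open>a\<^sub>3\<close>, which preserve a conic in \<open>X i\<^sub>2, X i\<^sub>3\<close> over the field generated
  by \<open>X i\<^sub>1\<close> and \<open>s\<close>, leaves only functions of \<open>X i\<^sub>1\<close> and \<open>s\<close>, that is, of \<open>T\<close> and \<open>w\<close>. Invariance
  under \<open>a\<^sub>1\<close> and \<open>a\<^sub>2\<close>, which fix \<open>T\<close> and move \<open>w\<close>, then eliminates \<open>w\<close>.
\<close>

lemma invariant_in_ratfun_field_of:
  assumes idx: "UNIV = {i\<^sub>1, i\<^sub>2, i\<^sub>3 :: 3}"
    and a2: "a\<^sub>2 i\<^sub>1 = X i\<^sub>1" "a\<^sub>2 i\<^sub>2 = s * X i\<^sub>3 - X i\<^sub>2" "a\<^sub>2 i\<^sub>3 = X i\<^sub>3"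
    and a3: "a\<^sub>3 i\<^sub>1 = X i\<^sub>1" "a\<^sub>3 i\<^sub>2 = X i\<^sub>2" "a\<^sub>3 i\<^sub>3 = s * X i\<^sub>2 - X i\<^sub>3"
    and f: "maps a\<^sub>1 f f" "maps a\<^sub>2 f f" "maps a\<^sub>3 f f"
    and s: "maps a\<^sub>2 s s" "maps a\<^sub>3 s s" "maps (\<lambda>_. 1) s 3"
    and norm: "X i\<^sub>2 * a\<^sub>2 i\<^sub>2 \<in> gen_ring {X i\<^sub>3, X i\<^sub>1, s}"
    and gens: "X i\<^sub>1 \<in> gen_ring {w, T, inverse T}" "s \<in> gen_ring {w, T, inverse T}"
    and T: "maps a\<^sub>1 T T" "maps a\<^sub>2 T T" "T \<noteq> 0"
    and w: "maps a\<^sub>1 w (s\<^sub>1 * q - w)" "maps a\<^sub>2 w w" "maps (\<lambda>_. 1) w (emb w\<^sub>0)"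
    and q: "maps a\<^sub>1 q q" "maps a\<^sub>2 q (s\<^sub>2 * w - q)" "maps (\<lambda>_. 1) q (emb q\<^sub>0)"
    and s1: "maps a\<^sub>1 s\<^sub>1 s\<^sub>1" "maps a\<^sub>2 s\<^sub>1 s\<^sub>1" "maps (\<lambda>_. 1) s\<^sub>1 (emb t\<^sub>1)"
    and s2: "maps a\<^sub>1 s\<^sub>2 s\<^sub>2" "maps a\<^sub>2 s\<^sub>2 s\<^sub>2" "maps (\<lambda>_. 1) s\<^sub>2 (emb t\<^sub>2)"
    and ineq: "t\<^sub>1 > 0" "t\<^sub>2 > 0" "t\<^sub>1 * t\<^sub>2 \<ge> 4" "q\<^sub>0 > 0" "2 * w\<^sub>0 < t\<^sub>1 * q\<^sub>0"
  shows "f \<in> ratfun_field_of T"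
proof -
  have X1: "maps (\<lambda>_. 1) (X i) (emb 1)" for i
    using maps_X by simp
  have s3: "maps (\<lambda>_. 1) s (emb 3)"
    using s(3) by simp
  \<comment> \<open>At (1, 1, 1) the left side is 3 - 1 = 2 and the right side is 1.\<close>
  have "a\<^sub>2 i\<^sub>2 \<noteq> X i\<^sub>2"
  proof
    assume "a\<^sub>2 i\<^sub>2 = X i\<^sub>2"
    moreover have "maps (\<lambda>_. 1) (a\<^sub>2 i\<^sub>2) (emb 3 * emb 1 - emb 1)"
      unfolding a2 by (intro maps_diff maps_mult X1 s3)
    ultimately have "emb 3 * emb 1 - emb 1 = emb 1"
      using X1 maps_unique by metis
    then have "emb (3 * 1 - 1) = emb 1"
      unfolding emb_diff emb_simps(4) .
    then show False
      unfolding emb_eq_iff by simp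
  qed
  moreover have "X i\<^sub>2 + a\<^sub>2 i\<^sub>2 \<in> gen_ring {X i\<^sub>3, X i\<^sub>1, s}"
  proof -
    have "X i\<^sub>2 + a\<^sub>2 i\<^sub>2 = s * X i\<^sub>3"
      by (simp add: a2)
    then show ?thesis
      by (auto intro: gen_ring.intros)
  qed
  moreover have "a\<^sub>2 j = X j \<and> X j \<in> gen_ring {X i\<^sub>3, X i\<^sub>1, s}" if "j \<noteq> i\<^sub>2" for j
  proof -
    have "j = i\<^sub>1 \<or> j = i\<^sub>3"
      using that idx by blast
    then show ?thesis
      by (auto simp: a2 intro: gen_ring.base)
  qed
  ultimately obtain u v where uv: "u \<in> gen_ring {X i\<^sub>3, X i\<^sub>1, s}" "v \<in> gen_ring {X i\<^sub>3, X i\<^sub>1, s}"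
    "v \<noteq> 0" "f * v = u"
    using fixed_by_involution[OF f(2)] norm by blast
  have E: "maps a\<^sub>2 e e" "maps a\<^sub>3 e e" if "e \<in> {X i\<^sub>1, s}" for e
    using that s a2 a3 by (auto intro: maps_X')
  \<comment> \<open>First elimination: \<open>p = X i\<^sub>3\<close>,
    \<open>q = X i\<^sub>2\<close>, both multipliers equal to \<open>s\<close>, with value 3 at (1,
    1, 1).\<close>
  have "\<exists>u v. u \<in> gen_ring {X i\<^sub>1, s} \<and> v \<in> gen_ring {X i\<^sub>1, s} \<and> v \<noteq> 0 \<and> f * v = u"
    by (rule fixed_by_orbit[OF maps_X'[of a\<^sub>3 i\<^sub>3, OF a3(3)] maps_X'[of a\<^sub>3 i\<^sub>2, OF a3(2)] s(2) s(2) f(3)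
          maps_X'[of a\<^sub>2 i\<^sub>3, OF a2(3)] maps_X'[of a\<^sub>2 i\<^sub>2, OF a2(2)] s(1) s(1) f(2) E(2) E(1) X1 X1 s3 s3 _ _ _ _ _ uv])
      simp_all
  moreover have "{X i\<^sub>1, s} \<subseteq> gen_ring {w, T, inverse T}"
    using gens by simp
  ultimately obtain u v where uv: "u \<in> gen_ring {w, T, inverse T}"
    "v \<in> gen_ring {w, T, inverse T}" "v \<noteq> 0" "f * v = u"
    using gen_ring_subset by metis
  \<comment> \<open>Second elimination: only \<open>T\<close> and its inverse remain as
    coefficients, and \<open>w\<close> runs through an orbit under \<open>a\<^sub>1\<close> and
    \<open>a\<^sub>2\<close>.\<close>
  have "maps a\<^sub>1 e e" "maps a\<^sub>2 e e" if "e \<in> {T, inverse T}" for e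
    using that T by (auto intro: maps_inverse)
  then obtain u v where "u \<in> gen_ring {T, inverse T}" "v \<in> gen_ring {T, inverse T}"
    "v \<noteq> 0" "f * v = u"
    using fixed_by_orbit[OF w(1) q(1) s1(1) s2(1) f(1) w(2) q(2) s1(2) s2(2) f(2) _ _
        w(3) q(3) s1(3) s2(3) ineq uv] by blast
  then show ?thesis
    using ratfun_field_of_divide gen_ring_subset_field by (metis nonzero_eq_divide_eq)
qed


section \<open>Permuted exchange matrices\<close>

text \<open>Direction \<open>\<sigma> k\<close> of the permuted matrix corresponds to column
  \<open>k\<close> of \<open>B\<close>, so each exchange relation reappears with
  \<open>X (\<sigma> j)\<close> for \<open>X j\<close>.\<close>

abbreviation permuted_mutation :: "(3 \<Rightarrow> 3) \<Rightarrow> int^3^3 \<Rightarrow> 3 \<Rightarrow> 3 \<Rightarrow> ratfun"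
  where "permuted_mutation \<sigma> B k \<equiv> mutation (permute_matrix \<sigma> B) (\<sigma> k)"

lemma ratfun_numeral_nonzero [simp]: "(numeral n :: ratfun) \<noteq> 0"
  using emb_eq_iff[of "numeral n" 0] by (simp del: emb_eq_iff)

text \<open>Both monomials of the numerator are 1 at (1, 1, 1), so their sum is 2 there.\<close>

lemma mutation_nonzero: "mutation B k i \<noteq> 0"
proof -
  have prod: "maps (\<lambda>_. 1) (\<Prod>j\<in>UNIV. X j ^ n j) 1" for n :: "3 \<Rightarrow> nat"
  proof -
    have "maps (\<lambda>_. 1) (X j ^ n j) 1" for j
      using maps_power[OF maps_X[of "\<lambda>_. 1" j], of "n j"] by simp
    then show ?thesis
      unfolding prod_UNIV_3 by (metis maps_mult mult_1)
  qed
  have "(\<Prod>j\<in>UNIV. X j ^ n j) + (\<Prod>j\<in>UNIV. X j ^ m j) \<noteq> 0" for n m :: "3 \<Rightarrow> nat"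
    by (rule maps_nonzero[OF maps_add[OF prod prod]]) simp
  then show ?thesis
    by (simp add: mutation_def)
qed

context
  fixes \<sigma> :: "3 \<Rightarrow> 3"
  assumes perm: "\<sigma> permutes UNIV"
begin

lemma perm_eq_iff: "\<sigma> i = \<sigma> j \<longleftrightarrow> i = j"
  using perm by (metis permutes_inverses(2))

lemma perm_UNIV: "UNIV = {\<sigma> 1, \<sigma> 2, \<sigma> 3}"
  using permutes_image[OF perm] UNIV_3 by (metis image_empty image_insert)

lemma permuted_mutation_other: "j \<noteq> k \<Longrightarrow> permuted_mutation \<sigma> B k (\<sigma> j) = X (\<sigma> j)"
  by (simp add: mutation_other perm_eq_iff)

lemma permuted_exchange: "X (\<sigma> k) * permuted_mutation \<sigma> B k (\<sigma> k) =
  (\<Prod>j\<in>UNIV. X (\<sigma> j) ^ nat (B $ j $ k)) + (\<Prod>j\<in>UNIV. X (\<sigma> j) ^ nat (- (B $ j $ k)))"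
proof -
  have B: "permute_matrix \<sigma> B $ \<sigma> j $ \<sigma> k = B $ j $ k" for j
    using permutes_inverses(2)[OF perm] by (simp add: permute_matrix_def)
  have reindex: "(\<Prod>j\<in>UNIV. g j) = (\<Prod>j\<in>UNIV. g (\<sigma> j))" for g :: "3 \<Rightarrow> ratfun"
    using prod.permute[OF perm, of g] by (simp add: o_def)
  show ?thesis
    unfolding mutation_def by (subst (1 2) reindex) (simp add: B)
qed

lemma exchange_B1:
  "X (\<sigma> 1) * permuted_mutation \<sigma> B1 1 (\<sigma> 1) = (X (\<sigma> 2))^2 + (X (\<sigma> 3))^2"
  "X (\<sigma> 2) * permuted_mutation \<sigma> B1 2 (\<sigma> 2) = (X (\<sigma> 1))^2 + (X (\<sigma> 3))^2"
  "X (\<sigma> 3) * permuted_mutation \<sigma> B1 3 (\<sigma> 3) = (X (\<sigma> 1))^2 + (X (\<sigma> 2))^2"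
  unfolding permuted_exchange by (simp_all add: B1_def prod_UNIV_3 add.commute)

lemma exchange_B2:
  "X (\<sigma> 1) * permuted_mutation \<sigma> B2 1 (\<sigma> 1) = (X (\<sigma> 2))^4 + (X (\<sigma> 3))^4"
  "X (\<sigma> 2) * permuted_mutation \<sigma> B2 2 (\<sigma> 2) = X (\<sigma> 1) + (X (\<sigma> 3))^2"
  "X (\<sigma> 3) * permuted_mutation \<sigma> B2 3 (\<sigma> 3) = X (\<sigma> 1) + (X (\<sigma> 2))^2"
  unfolding permuted_exchange by (simp_all add: B2_def prod_UNIV_3 add.commute)

lemma exchange_B3:
  "X (\<sigma> 1) * permuted_mutation \<sigma> B3 1 (\<sigma> 1) = X (\<sigma> 2) + X (\<sigma> 3)"
  "X (\<sigma> 2) * permuted_mutation \<sigma> B3 2 (\<sigma> 2) = (X (\<sigma> 1))^4 + (X (\<sigma> 3))^2"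
  "X (\<sigma> 3) * permuted_mutation \<sigma> B3 3 (\<sigma> 3) = (X (\<sigma> 1))^4 + (X (\<sigma> 2))^2"
  unfolding permuted_exchange by (simp_all add: B3_def prod_UNIV_3 add.commute)

lemma invariant_imp_maps:
  "f \<in> invariant_field (permute_matrix \<sigma> B) \<Longrightarrow> maps (permuted_mutation \<sigma> B k) f f"
  by (simp add: invariant_field_iff)

end


section \<open>The three invariants\<close>

lemma maps_T1:
  assumes "maps a x x'" "maps a y y'" "maps a z z'" "x' \<noteq> 0" "y' \<noteq> 0" "z' \<noteq> 0"
  shows "maps a (T1 x y z) (T1 x' y' z')"
  unfolding T1_def using assms by (intro maps_intros) simp_all

lemma maps_T2:
  assumes "maps a x x'" "maps a y y'" "maps a z z'" "x' \<noteq> 0" "y' \<noteq> 0" "z' \<noteq> 0"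
  shows "maps a (T2 x y z) (T2 x' y' z')"
  unfolding T2_def using assms by (intro maps_intros) simp_all

lemma maps_T3:
  assumes "maps a x x'" "maps a y y'" "maps a z z'" "x' \<noteq> 0" "y' \<noteq> 0" "z' \<noteq> 0"
  shows "maps a (T3 x y z) (T3 x' y' z')"
  unfolding T3_def using assms by (intro maps_intros) simp_all

lemma T1_commute: "T1 x y z = T1 y x z" "T1 x y z = T1 z y x"
  unfolding T1_def by (simp_all add: add_ac mult_ac)

lemma T2_commute: "T2 x y z = T2 x z y"
  unfolding T2_def by (simp add: add_ac mult_ac)

lemma T3_commute: "T3 x y z = T3 x z y"
  unfolding T3_def by (simp add: add_ac mult_ac)

text \<open>The right side is symmetric in \<open>x\<close> and its mutation \<open>x'\<close>. This
  gives the invariance, and also makes the mutation linear: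
  \<open>x' = T1 x y z * y * z - x\<close>.\<close>

lemma T1_exchange:
  assumes "x * x' = y^2 + z^2" "x \<noteq> 0"
  shows "T1 x y z = (x + x') / (y * z)"
proof -
  have "x^2 + y^2 + z^2 = x * (x + x')"
    unfolding distrib_left assms(1) by (simp add: power2_eq_square)
  then show ?thesis
    using assms(2) by (simp add: T1_def mult.assoc)
qed

lemma T2_exchange_1:
  assumes "x * x' = y^4 + z^4" "x \<noteq> 0"
  shows "T2 x y z = (x + x' + 2 * y^2 + 2 * z^2) / (y^2 * z^2)"
proof -
  have "x^2 + y^4 + z^4 + 2 * x * y^2 + 2 * x * z^2 = x * (x + x' + 2 * y^2 + 2 * z^2)"
    unfolding distrib_left assms(1) by (simp add: power2_eq_square mult_ac)
  then show ?thesis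
    using assms(2) by (simp add: T2_def mult.assoc)
qed

text \<open>The numerator contains the square of the exchange polynomial \<open>x + z^2\<close>,
  which allows \<open>y^2\<close> to be factored out.\<close>

lemma T2_exchange_2:
  assumes "y * y' = x + z^2" "y \<noteq> 0"
  shows "T2 x y z = (y^2 + y'^2 + 2 * x) / (x * z^2)"
proof -
  have "x^2 + y^4 + z^4 + 2 * x * y^2 + 2 * x * z^2 = (x + z^2)^2 + y^2 * (y^2 + 2 * x)"
    by (simp add: algebra_simps power2_eq_square power4_eq_xxxx)
  also have "\<dots> = y^2 * (y^2 + y'^2 + 2 * x)"
    unfolding assms(1)[symmetric] by (simp add: algebra_simps)
  finally show ?thesis
    using assms(2) by (simp add: T2_def mult_ac)
qed

lemma T3_exchange_1:
  assumes "x * x' = y + z" "x \<noteq> 0"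
  shows "T3 x y z = (x^2 + x'^2) / (y * z)"
proof -
  have "x^4 + y^2 + z^2 + 2 * y * z = x^4 + (y + z)^2"
    by (simp add: algebra_simps power2_eq_square)
  also have "\<dots> = x^2 * (x^2 + x'^2)"
    unfolding assms(1)[symmetric] by (simp add: algebra_simps flip: power_add)
  finally show ?thesis
    using assms(2) by (simp add: T3_def mult.assoc)
qed

lemma T3_exchange_2:
  assumes "y * y' = x^4 + z^2" "y \<noteq> 0"
  shows "T3 x y z = (y + y' + 2 * z) / (x^2 * z)"
proof -
  have "x^4 + y^2 + z^2 + 2 * y * z = (x^4 + z^2) + y^2 + 2 * y * z"
    by simp
  also have "\<dots> = y * (y + y' + 2 * z)"
    unfolding assms(1)[symmetric] by (simp add: algebra_simps power2_eq_square)
  finally show ?thesis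
    using assms(2) by (simp add: T3_def mult_ac)
qed


text \<open>Swapping \<open>x\<close> and \<open>x'\<close> preserves both the exchange relation and
  the symmetric form.\<close>

lemma T1_invariant: "x * x' = y^2 + z^2 \<Longrightarrow> x \<noteq> 0 \<Longrightarrow> x' \<noteq> 0 \<Longrightarrow> T1 x' y z = T1 x y z"
  using T1_exchange[of x x' y z] T1_exchange[of x' x y z] by (simp add: mult.commute add.commute)

lemma T2_invariant_1:
  "x * x' = y^4 + z^4 \<Longrightarrow> x \<noteq> 0 \<Longrightarrow> x' \<noteq> 0 \<Longrightarrow> T2 x' y z = T2 x y z"
  using T2_exchange_1[of x x' y z] T2_exchange_1[of x' x y z] by (simp add: mult.commute add.commute)

lemma T2_invariant_2:
  "y * y' = x + z^2 \<Longrightarrow> y \<noteq> 0 \<Longrightarrow> y' \<noteq> 0 \<Longrightarrow> T2 x y' z = T2 x y z"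
  using T2_exchange_2[of y y' x z] T2_exchange_2[of y' y x z] by (simp add: mult.commute add.commute)

lemma T3_invariant_1:
  "x * x' = y + z \<Longrightarrow> x \<noteq> 0 \<Longrightarrow> x' \<noteq> 0 \<Longrightarrow> T3 x' y z = T3 x y z"
  using T3_exchange_1[of x x' y z] T3_exchange_1[of x' x y z] by (simp add: mult.commute add.commute)

lemma T3_invariant_2:
  "y * y' = x^4 + z^2 \<Longrightarrow> y \<noteq> 0 \<Longrightarrow> y' \<noteq> 0 \<Longrightarrow> T3 x y' z = T3 x y z"
  using T3_exchange_2[of y y' x z] T3_exchange_2[of y' y x z] by (simp add: mult.commute add.commute)

section \<open>Invariance under the permuted mutations, and the three fixed fields\<close>

context
  fixes \<sigma> :: "3 \<Rightarrow> 3"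
  assumes perm: "\<sigma> permutes UNIV"
begin

lemmas other = permuted_mutation_other[OF perm]

lemma maps_T1_permuted_mutation:
  "maps (permuted_mutation \<sigma> B1 k) (T1 (X (\<sigma> 1)) (X (\<sigma> 2)) (X (\<sigma> 3)))
    (T1 (X (\<sigma> 1)) (X (\<sigma> 2)) (X (\<sigma> 3)))"
proof -
  let ?x = "X (\<sigma> 1)" and ?y = "X (\<sigma> 2)" and ?z = "X (\<sigma> 3)"
  let ?a = "permuted_mutation \<sigma> B1"
  let ?T = "T1 ?x ?y ?z"
  have "maps (?a k) ?T (T1 (?a k (\<sigma> 1)) (?a k (\<sigma> 2)) (?a k (\<sigma> 3)))"
    by (intro maps_T1 maps_X mutation_nonzero)
  moreover have "T1 (?a 1 (\<sigma> 1)) ?y ?z = ?T"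
    by (intro T1_invariant exchange_B1 perm mutation_nonzero X_nonzero)
  moreover have "T1 ?x (?a 2 (\<sigma> 2)) ?z = ?T"
    using T1_invariant[OF exchange_B1(2)[OF perm]] by (simp add: mutation_nonzero T1_commute(1)[of ?x])
  moreover have "T1 ?x ?y (?a 3 (\<sigma> 3)) = ?T"
    using T1_invariant[of ?z "?a 3 (\<sigma> 3)" ?y ?x] exchange_B1(3)[OF perm]
    by (simp add: mutation_nonzero T1_commute(2)[of ?x] add.commute)
  ultimately show ?thesis
    using exhaust_3[of k] by (auto simp: other)
qed

lemma maps_T2_permuted_mutation:
  "maps (permuted_mutation \<sigma> B2 k) (T2 (X (\<sigma> 1)) (X (\<sigma> 2)) (X (\<sigma> 3)))
    (T2 (X (\<sigma> 1)) (X (\<sigma> 2)) (X (\<sigma> 3)))"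
proof -
  let ?x = "X (\<sigma> 1)" and ?y = "X (\<sigma> 2)" and ?z = "X (\<sigma> 3)"
  let ?a = "permuted_mutation \<sigma> B2"
  let ?T = "T2 ?x ?y ?z"
  have "maps (?a k) ?T (T2 (?a k (\<sigma> 1)) (?a k (\<sigma> 2)) (?a k (\<sigma> 3)))"
    by (intro maps_T2 maps_X mutation_nonzero)
  moreover have "T2 (?a 1 (\<sigma> 1)) ?y ?z = ?T"
    by (intro T2_invariant_1 exchange_B2 perm mutation_nonzero X_nonzero)
  moreover have "T2 ?x (?a 2 (\<sigma> 2)) ?z = ?T"
    by (intro T2_invariant_2 exchange_B2 perm mutation_nonzero X_nonzero)
  moreover have "T2 ?x ?y (?a 3 (\<sigma> 3)) = ?T"
    unfolding T2_commute[of ?x ?y]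
    by (intro T2_invariant_2 exchange_B2 perm mutation_nonzero X_nonzero)
  ultimately show ?thesis
    using exhaust_3[of k] by (auto simp: other)
qed

lemma maps_T3_permuted_mutation:
  "maps (permuted_mutation \<sigma> B3 k) (T3 (X (\<sigma> 1)) (X (\<sigma> 2)) (X (\<sigma> 3)))
    (T3 (X (\<sigma> 1)) (X (\<sigma> 2)) (X (\<sigma> 3)))"
proof -
  let ?x = "X (\<sigma> 1)" and ?y = "X (\<sigma> 2)" and ?z = "X (\<sigma> 3)"
  let ?a = "permuted_mutation \<sigma> B3"
  let ?T = "T3 ?x ?y ?z"
  have "maps (?a k) ?T (T3 (?a k (\<sigma> 1)) (?a k (\<sigma> 2)) (?a k (\<sigma> 3)))"
    by (intro maps_T3 maps_X mutation_nonzero)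
  moreover have "T3 (?a 1 (\<sigma> 1)) ?y ?z = ?T"
    by (intro T3_invariant_1 exchange_B3 perm mutation_nonzero X_nonzero)
  moreover have "T3 ?x (?a 2 (\<sigma> 2)) ?z = ?T"
    by (intro T3_invariant_2 exchange_B3 perm mutation_nonzero X_nonzero)
  moreover have "T3 ?x ?y (?a 3 (\<sigma> 3)) = ?T"
    unfolding T3_commute[of ?x ?y]
    by (intro T3_invariant_2 exchange_B3 perm mutation_nonzero X_nonzero)
  ultimately show ?thesis
    using exhaust_3[of k] by (auto simp: other)
qed

text \<open>Every mutation is linear over \<open>T\<close>: with \<open>s = T x\<close>,
  \<open>y\<close> and \<open>z\<close> are reflected for fixed \<open>x\<close>; with multiplier
  \<open>T z\<close>, \<open>x\<close> and \<open>y\<close> are reflected for fixed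
  \<open>z\<close>. Hence \<open>w = x\<close> and \<open>q = y\<close>.\<close>

lemma invariant_field_B1:
  assumes "f \<in> invariant_field (permute_matrix \<sigma> B1)"
  shows "f \<in> ratfun_field_of (T1 (X (\<sigma> 1)) (X (\<sigma> 2)) (X (\<sigma> 3)))"
proof -
  let ?x = "X (\<sigma> 1)" and ?y = "X (\<sigma> 2)" and ?z = "X (\<sigma> 3)"
  let ?a = "permuted_mutation \<sigma> B1"
  let ?T = "T1 ?x ?y ?z"
  have f: "maps (?a k) f f" for k
    by (rule invariant_imp_maps[OF perm assms])
  have T: "maps (?a k) ?T ?T" for k
    by (rule maps_T1_permuted_mutation)
  have X1: "maps (\<lambda>_. 1) (X i) 1" for i
    by (rule maps_X)
  have "maps (\<lambda>_. 1) ?T (T1 1 1 1)"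
    by (intro maps_T1 X1) simp_all
  then have T1: "maps (\<lambda>_. 1) ?T 3"
    by (simp add: T1_def)
  then have "?T \<noteq> 0"
    by (rule maps_nonzero) simp
  have fix1: "maps (?a 1) ?y ?y" "maps (?a 1) ?z ?z" and fix2: "maps (?a 2) ?x ?x" "maps (?a 2) ?z ?z"
    and fix3: "maps (?a 3) ?x ?x" "maps (?a 3) ?y ?y"
    by (simp_all add: maps_X' other)
  have "?T * ?x * ?z = ?y + ?a 2 (\<sigma> 2)"
    unfolding T1_commute(1)[of ?x] T1_exchange[OF exchange_B1(2)[OF perm] X_nonzero] by simp
  then have a2: "?a 2 (\<sigma> 2) = ?T * ?x * ?z - ?y"
    by simp
  have "?z * ?a 3 (\<sigma> 3) = ?y^2 + ?x^2"
    using exchange_B1(3)[OF perm] by (simp add: add.commute)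
  then have "?T * ?x * ?y = ?z + ?a 3 (\<sigma> 3)"
    unfolding T1_commute(2)[of ?x] by (simp add: T1_exchange)
  then have a3: "?a 3 (\<sigma> 3) = ?T * ?x * ?y - ?z"
    by simp
  have "?T * ?z * ?y = ?x + ?a 1 (\<sigma> 1)"
    unfolding T1_exchange[OF exchange_B1(1)[OF perm] X_nonzero] by simp
  then have a1: "?a 1 (\<sigma> 1) = ?T * ?z * ?y - ?x"
    by simp
  have s1: "maps (\<lambda>_. 1) (?T * X i) 3" for i
    using maps_mult[OF T1 X1] by simp
  show ?thesis
  proof (rule invariant_in_ratfun_field_of[where i\<^sub>1 = "\<sigma> 1" and i\<^sub>2 = "\<sigma> 2" and i\<^sub>3 = "\<sigma> 3" and a\<^sub>1 = "?a 1" and a\<^sub>2 = "?a 2" and a\<^sub>3 = "?a 3" and s = "?T * ?x" and w = "?x" and q = "?y" and s\<^sub>1 = "?T * ?z" and s\<^sub>2 = "?T * ?z" and w\<^sub>0 = "1" and q\<^sub>0 = "1" and t\<^sub>1 = "3" and t\<^sub>2 = "3"])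
    show "?y * ?a 2 (\<sigma> 2) \<in> gen_ring {?z, ?x, ?T * ?x}"
      unfolding exchange_B1[OF perm] by (auto intro!: gen_ring.add gen_ring_power intro: gen_ring.base)
    show "?x \<in> gen_ring {?x, ?T, inverse ?T}" "?T * ?x \<in> gen_ring {?x, ?T, inverse ?T}"
      by (auto intro: gen_ring.intros)
    show "maps (?a 1) ?x (?T * ?z * ?y - ?x)" "maps (?a 2) ?y (?T * ?z * ?x - ?y)"
      using a1 a2 by (simp_all add: maps_X' mult_ac)
    show "maps (?a 2) (?T * ?x) (?T * ?x)" "maps (?a 3) (?T * ?x) (?T * ?x)"
      "maps (?a 1) (?T * ?z) (?T * ?z)" "maps (?a 2) (?T * ?z) (?T * ?z)"
      "maps (?a 1) (?T * ?z) (?T * ?z)" "maps (?a 2) (?T * ?z) (?T * ?z)"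
      by (intro maps_mult T fix1 fix2 fix3)+
  qed (fact perm_UNIV[OF perm] a2 a3 f T \<open>?T \<noteq> 0\<close> fix1 fix2 s1 | simp add: other X1 s1)+
qed

text \<open>The quantity \<open>w\<close> equals \<open>(y + y') / z\<close> and
  \<open>(z + z') / y\<close>, so the mutations of \<open>y\<close> and \<open>z\<close> fix it and
  \<open>s = w\<close>. In the second stage it is paired with \<open>y\<close>.\<close>

lemma invariant_field_B2:
  assumes "f \<in> invariant_field (permute_matrix \<sigma> B2)"
  shows "f \<in> ratfun_field_of (T2 (X (\<sigma> 1)) (X (\<sigma> 2)) (X (\<sigma> 3)))"
proof -
  let ?x = "X (\<sigma> 1)" and ?y = "X (\<sigma> 2)" and ?z = "X (\<sigma> 3)"
  let ?a = "permuted_mutation \<sigma> B2"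
  let ?T = "T2 ?x ?y ?z"
  have f: "maps (?a k) f f" for k
    by (rule invariant_imp_maps[OF perm assms])
  have T: "maps (?a k) ?T ?T" for k
    by (rule maps_T2_permuted_mutation)
  have X1: "maps (\<lambda>_. 1) (X i) 1" for i
    by (rule maps_X)
  have "maps (\<lambda>_. 1) ?T (T2 1 1 1)"
    by (intro maps_T2 X1) simp_all
  then have T1: "maps (\<lambda>_. 1) ?T 7"
    by (simp add: T2_def)
  then have "?T \<noteq> 0"
    by (rule maps_nonzero) simp
  have fix1: "maps (?a 1) ?y ?y" "maps (?a 1) ?z ?z" and fix2: "maps (?a 2) ?x ?x" "maps (?a 2) ?z ?z"
    and fix3: "maps (?a 3) ?x ?x" "maps (?a 3) ?y ?y"
    by (simp_all add: maps_X' other)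
  txt \<open>The square of \<open>w\<close> is \<open>T x + 2\<close>, so the field generated by \<open>x\<close> and \<open>w\<close> is generated by \<open>T\<close> and \<open>w\<close>.\<close>
  let ?w = "(?x + ?y^2 + ?z^2) / (?y * ?z)"
  have nz: "?a 1 (\<sigma> 1) \<noteq> 0" "?a 2 (\<sigma> 2) \<noteq> 0" "?a 3 (\<sigma> 3) \<noteq> 0"
    by (rule mutation_nonzero)+
  have w2: "(?x + y^2 + ?z^2) / (y * ?z) = (y + y') / ?z" if "y * y' = ?x + ?z^2" "y \<noteq> 0" for y y'
  proof -
    have "?x + y^2 + ?z^2 = y * (y + y')"
      unfolding distrib_left that(1) by (simp add: power2_eq_square)
    with that(2) show ?thesis by simp
  qed
  have w3: "(?x + ?y^2 + z^2) / (?y * z) = (z + z') / ?y" if "z * z' = ?x + ?y^2" "z \<noteq> 0" for z z'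
  proof -
    have "?x + ?y^2 + z^2 = z * (z + z')"
      unfolding distrib_left that(1) by (simp add: power2_eq_square)
    with that(2) show ?thesis by simp
  qed
  have a2: "?a 2 (\<sigma> 2) = ?w * ?z - ?y"
    unfolding w2[OF exchange_B2(2)[OF perm] X_nonzero] by simp
  have a3: "?a 3 (\<sigma> 3) = ?w * ?y - ?z"
    unfolding w3[OF exchange_B2(3)[OF perm] X_nonzero] by simp
  have "maps (?a 2) ?w ((?x + (?a 2 (\<sigma> 2))^2 + ?z^2) / (?a 2 (\<sigma> 2) * ?z))"
    by (intro maps_intros fix2 maps_X) (simp add: nz)
  moreover have "(?x + (?a 2 (\<sigma> 2))^2 + ?z^2) / (?a 2 (\<sigma> 2) * ?z) = ?w"
    using w2[OF exchange_B2(2)[OF perm]] w2[of "?a 2 (\<sigma> 2)" ?y] exchange_B2(2)[OF perm] nz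
    by (simp add: mult.commute add.commute)
  ultimately have W2: "maps (?a 2) ?w ?w"
    by simp
  have "maps (?a 3) ?w ((?x + ?y^2 + (?a 3 (\<sigma> 3))^2) / (?y * ?a 3 (\<sigma> 3)))"
    by (intro maps_intros fix3 maps_X) (simp add: nz)
  moreover have "(?x + ?y^2 + (?a 3 (\<sigma> 3))^2) / (?y * ?a 3 (\<sigma> 3)) = ?w"
    using w3[OF exchange_B2(3)[OF perm]] w3[of "?a 3 (\<sigma> 3)" ?z] exchange_B2(3)[OF perm] nz
    by (simp add: mult.commute add.commute)
  ultimately have W3: "maps (?a 3) ?w ?w"
    by simp
  have "maps (?a 1) ?w ((?a 1 (\<sigma> 1) + ?y^2 + ?z^2) / (?y * ?z))"
    by (intro maps_intros fix1 maps_X) simp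
  \<comment> \<open>The sum of \<open>w\<close> and its image is \<open>T y z\<close>, by the
    symmetric form of \<open>T\<close> in \<open>x\<close> and \<open>x'\<close>.\<close>
  moreover have "(?a 1 (\<sigma> 1) + ?y^2 + ?z^2) / (?y * ?z) = ?T * ?z * ?y - ?w"
    unfolding T2_exchange_1[OF exchange_B2(1)[OF perm] X_nonzero]
    by (simp add: field_simps power2_eq_square)
  ultimately have W1: "maps (?a 1) ?w (?T * ?z * ?y - ?w)"
    by simp
  have "maps (\<lambda>_. 1) ?w ((1 + 1^2 + 1^2) / (1 * 1))"
    by (intro maps_intros X1) simp
  then have W: "maps (\<lambda>_. 1) ?w 3" and W0: "maps (\<lambda>_. 1) ?w (emb 3)"
    by simp_all
  have s1: "maps (\<lambda>_. 1) (?T * ?z) (emb 7)"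
    using maps_mult[OF T1 X1] by simp
  have "?T * ?x = ?w^2 - 2"
    unfolding T2_def by (simp add: field_simps power2_eq_square power4_eq_xxxx)
  then have x: "?x = (?w * ?w - 2) * inverse ?T"
    using \<open>?T \<noteq> 0\<close> by (simp add: field_simps power2_eq_square)
  show ?thesis
  \<comment> \<open>At (1, 1, 1) one has \<open>T = 7\<close> and \<open>w = 3\<close>, so the
    growth condition reads 6 < 7.\<close>
  proof (rule invariant_in_ratfun_field_of[where i\<^sub>1 = "\<sigma> 1" and i\<^sub>2 = "\<sigma> 2" and i\<^sub>3 = "\<sigma> 3" and a\<^sub>1 = "?a 1" and a\<^sub>2 = "?a 2" and a\<^sub>3 = "?a 3" and s = "?w" and w = "?w" and q = "?y" and s\<^sub>1 = "?T * ?z" and s\<^sub>2 = "?z" and w\<^sub>0 = "3" and q\<^sub>0 = "1" and t\<^sub>1 = "7" and t\<^sub>2 = "1"])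
    show "?y * ?a 2 (\<sigma> 2) \<in> gen_ring {?z, ?x, ?w}"
      unfolding exchange_B2[OF perm] by (auto intro!: gen_ring.add gen_ring_power intro: gen_ring.base)
    show "?w \<in> gen_ring {?w, ?T, inverse ?T}"
      by (auto intro: gen_ring.base)
    have "(w * w - 2) * inverse T \<in> gen_ring {w, T, inverse T}" for w T
      by (intro gen_ring.mult gen_ring_diff gen_ring_numeral gen_ring.base) simp_all
    from this[of ?w ?T] show "?x \<in> gen_ring {?w, ?T, inverse ?T}"
      unfolding x[symmetric] .
    show "maps (?a 2) ?y (?z * ?w - ?y)"
      using a2 by (intro maps_X') (simp add: mult.commute)
    show "maps (?a 1) (?T * ?z) (?T * ?z)" "maps (?a 2) (?T * ?z) (?T * ?z)"
      by (intro maps_mult T fix1 fix2)+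
  qed (fact perm_UNIV[OF perm] a2 a3 f T \<open>?T \<noteq> 0\<close> fix1 fix2 s1 W W0 W1 W2 W3 | simp add: other X1)+
qed

text \<open>The relation \<open>y + y' + 2 z = T x^2 z\<close> gives \<open>s = T x^2 - 2\<close>.
  In the second stage \<open>x' = q - x\<close>, so one multiplier is 1; the same relation shows
  that the mutation of \<open>y\<close> reflects \<open>q\<close> with multiplier
  \<open>2 + T z\<close>.\<close>

lemma invariant_field_B3:
  assumes "f \<in> invariant_field (permute_matrix \<sigma> B3)"
  shows "f \<in> ratfun_field_of (T3 (X (\<sigma> 1)) (X (\<sigma> 2)) (X (\<sigma> 3)))"
proof -
  let ?x = "X (\<sigma> 1)" and ?y = "X (\<sigma> 2)" and ?z = "X (\<sigma> 3)"
  let ?a = "permuted_mutation \<sigma> B3"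
  let ?T = "T3 ?x ?y ?z"
  have f: "maps (?a k) f f" for k
    by (rule invariant_imp_maps[OF perm assms])
  have T: "maps (?a k) ?T ?T" for k
    by (rule maps_T3_permuted_mutation)
  have X1: "maps (\<lambda>_. 1) (X i) 1" for i
    by (rule maps_X)
  have "maps (\<lambda>_. 1) ?T (T3 1 1 1)"
    by (intro maps_T3 X1) simp_all
  then have T1: "maps (\<lambda>_. 1) ?T 5"
    by (simp add: T3_def)
  then have "?T \<noteq> 0"
    by (rule maps_nonzero) simp
  have fix1: "maps (?a 1) ?y ?y" "maps (?a 1) ?z ?z" and fix2: "maps (?a 2) ?x ?x" "maps (?a 2) ?z ?z"
    and fix3: "maps (?a 3) ?x ?x" "maps (?a 3) ?y ?y"
    by (simp_all add: maps_X' other)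
  txt \<open>The element \<open>q\<close> is \<open>x + x'\<close>, where \<open>x'\<close> is the mutation of \<open>x\<close>.\<close>
  let ?s = "?T * ?x^2 - 2" and ?q = "?x + (?y + ?z) / ?x"
  have nz: "?a 1 (\<sigma> 1) \<noteq> 0"
    by (rule mutation_nonzero)
  have "?T * ?x^2 * ?z = ?y + ?a 2 (\<sigma> 2) + 2 * ?z"
    unfolding T3_exchange_2[OF exchange_B3(2)[OF perm] X_nonzero] by simp
  then have a2: "?a 2 (\<sigma> 2) = ?s * ?z - ?y"
    by (simp add: algebra_simps)
  have "?T * ?x^2 * ?y = ?z + ?a 3 (\<sigma> 3) + 2 * ?y"
    unfolding T3_commute[of ?x ?y] T3_exchange_2[OF exchange_B3(3)[OF perm] X_nonzero] by simp
  then have a3: "?a 3 (\<sigma> 3) = ?s * ?y - ?z"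
    by (simp add: algebra_simps)
  have a1: "?a 1 (\<sigma> 1) = (?y + ?z) / ?x"
    unfolding exchange_B3(1)[OF perm, symmetric] by simp
  have "maps (?a 1) ?q (?a 1 (\<sigma> 1) + (?y + ?z) / ?a 1 (\<sigma> 1))"
    by (intro maps_intros fix1 maps_X nz)
  moreover have "?a 1 (\<sigma> 1) + (?y + ?z) / ?a 1 (\<sigma> 1) = ?q"
    using nz unfolding exchange_B3(1)[OF perm, symmetric] by simp
  ultimately have Q1: "maps (?a 1) ?q ?q"
    by simp
  have "maps (?a 2) ?q (?x + (?a 2 (\<sigma> 2) + ?z) / ?x)"
    by (intro maps_intros fix2 maps_X X_nonzero)
  moreover have "?x + (?a 2 (\<sigma> 2) + ?z) / ?x = (2 + ?T * ?z) * ?x - ?q"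
    unfolding a2 by (simp add: field_simps power2_eq_square)
  ultimately have Q2: "maps (?a 2) ?q ((2 + ?T * ?z) * ?x - ?q)"
    by simp
  have "maps (\<lambda>_. 1) ?q (1 + (1 + 1) / 1)"
    by (intro maps_intros X1) simp
  then have Q: "maps (\<lambda>_. 1) ?q (emb 3)"
    by simp
  have "maps (\<lambda>_. 1) ?s (5 * 1^2 - 2)"
    by (intro maps_intros X1 T1)
  then have s: "maps (\<lambda>_. 1) ?s 3"
    by simp
  have "maps (\<lambda>_. 1) (2 + ?T * ?z) (2 + 5 * 1)"
    by (intro maps_intros X1 T1)
  then have s2: "maps (\<lambda>_. 1) (2 + ?T * ?z) (emb 7)"
    by simp
  show ?thesis
  proof (rule invariant_in_ratfun_field_of[where i\<^sub>1 = "\<sigma> 1" and i\<^sub>2 = "\<sigma> 2" and i\<^sub>3 = "\<sigma> 3" and a\<^sub>1 = "?a 1" and a\<^sub>2 = "?a 2" and a\<^sub>3 = "?a 3" and s = "?s" and w = "?x" and q = "?q" and s\<^sub>1 = "1" and s\<^sub>2 = "2 + ?T * ?z" and w\<^sub>0 = "1" and q\<^sub>0 = "3" and t\<^sub>1 = "1" and t\<^sub>2 = "7"])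
    show "?y * ?a 2 (\<sigma> 2) \<in> gen_ring {?z, ?x, ?s}"
      unfolding exchange_B3[OF perm] by (auto intro!: gen_ring.add gen_ring_power intro: gen_ring.base)
    show "?x \<in> gen_ring {?x, ?T, inverse ?T}"
      by (auto intro: gen_ring.base)
    show "?s \<in> gen_ring {?x, ?T, inverse ?T}"
      by (intro gen_ring_diff gen_ring.mult gen_ring_power gen_ring_numeral gen_ring.base) simp_all
    show "maps (?a 1) ?x (1 * ?q - ?x)"
      using a1 by (intro maps_X') simp
    show "maps (?a 2) ?s ?s" "maps (?a 3) ?s ?s"
      "maps (?a 1) (2 + ?T * ?z) (2 + ?T * ?z)" "maps (?a 2) (2 + ?T * ?z) (2 + ?T * ?z)"
      by (intro maps_intros T fix1 fix2 fix3)+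
  qed (fact perm_UNIV[OF perm] a2 a3 f T \<open>?T \<noteq> 0\<close> fix1 fix2 Q Q1 Q2 s s2 | simp add: other X1 maps_1)+
qed

end

section \<open>Laurent property of the invariants and the two equalities for every
  permutation\<close>

lemma T1_in_laurent_ring: "T1 (X i) (X j) (X k) \<in> laurent_ring"
  unfolding laurent_ring_eq T1_def divide_inverse inverse_mult_distrib power_inverse[symmetric]
  by (intro gen_ring.add gen_ring.mult gen_ring_power gen_ring_numeral) (auto intro: gen_ring.base)

lemma T2_in_laurent_ring: "T2 (X i) (X j) (X k) \<in> laurent_ring"
  unfolding laurent_ring_eq T2_def divide_inverse inverse_mult_distrib power_inverse[symmetric]
  by (intro gen_ring.add gen_ring.mult gen_ring_power gen_ring_numeral) (auto intro: gen_ring.base)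

lemma T3_in_laurent_ring: "T3 (X i) (X j) (X k) \<in> laurent_ring"
  unfolding laurent_ring_eq T3_def divide_inverse inverse_mult_distrib power_inverse[symmetric]
  by (intro gen_ring.add gen_ring.mult gen_ring_power gen_ring_numeral) (auto intro: gen_ring.base)

lemma permuted_invariants:
  assumes "\<sigma> permutes UNIV" "(B, T) \<in> {(B1, T1), (B2, T2), (B3, T3)}"
  defines "t \<equiv> T (X (\<sigma> 1)) (X (\<sigma> 2)) (X (\<sigma> 3))"
  shows "invariant_field (permute_matrix \<sigma> B) = ratfun_field_of t"
    and "invariant_field (permute_matrix \<sigma> B) \<inter> laurent_ring = poly_ring_of t"
proof -
  let ?I = "invariant_field (permute_matrix \<sigma> B)"
  have fixed: "maps (permuted_mutation \<sigma> B k) t t" for k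
    using assms maps_T1_permuted_mutation maps_T2_permuted_mutation maps_T3_permuted_mutation
    by auto
  have fixed': "maps (mutation (permute_matrix \<sigma> B) k) t t" for k
    using fixed[of "inv \<sigma> k"] permutes_inverses(1)[OF assms(1)] by simp
  have subset: "f \<in> ratfun_field_of t" if "f \<in> ?I" for f
    using assms that invariant_field_B1 invariant_field_B2 invariant_field_B3 by auto
  then show I: "?I = ratfun_field_of t"
    using maps_ratfun_field_of[OF fixed'] by (auto simp: invariant_field_iff)
  have laurent: "t \<in> laurent_ring"
    using assms(2) T1_in_laurent_ring T2_in_laurent_ring T3_in_laurent_ring
    unfolding t_def by auto
  have "\<exists>\<rho> n. (\<forall>i. \<rho> i = X 1 \<or> \<rho> i = 1) \<and> maps \<rho> t (poly_at n (X 1) / X 1) \<and>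
      degree n = 2 \<and> coeff n 0 \<noteq> 0"
  proof -
    \<comment> \<open>The variable kept is \<open>x\<close> for \<open>T1\<close> and
      \<open>T2\<close> but \<open>y\<close> for \<open>T3\<close>, since
      \<open>T3 x 1 1 = (x^4 + 4) / x^2\<close> does not have the form of a quadratic divided by the
      variable.\<close>
    define \<rho> where "\<rho> = (\<lambda>j i. if i = \<sigma> j then X 1 else 1)"
    have \<rho>: "maps (\<rho> j) (X (\<sigma> i)) (if i = j then X 1 else 1)" for i j
      by (rule maps_X') (simp add: \<rho>_def perm_eq_iff[OF assms(1)])
    have val: "\<forall>i. \<rho> j i = X 1 \<or> \<rho> j i = 1" for j
      by (simp add: \<rho>_def)
    have poly: "poly_at [:2, c, 1:] (X 1) = 2 + emb c * X 1 + (X 1)^2" for c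
      by (simp add: poly_at_pCons algebra_simps power2_eq_square)
    consider "T = T1" | "T = T2" | "T = T3"
      using assms(2) by auto
    then show ?thesis
    proof cases
      case 1
      have "maps (\<rho> 1) t (T1 (X 1) 1 1)"
        unfolding t_def 1 using \<rho>[of 1 1] \<rho>[of 1 2] \<rho>[of 1 3] by (intro maps_T1) simp_all
      moreover have "T1 (X 1) 1 1 = poly_at [:2, 0, 1:] (X 1) / X 1"
        unfolding poly by (simp add: T1_def)
      ultimately show ?thesis
        using val by (intro exI[of _ "\<rho> 1"] exI[of _ "[:2, 0, 1:]"]) simp
    next
      case 2
      have "maps (\<rho> 1) t (T2 (X 1) 1 1)"
        unfolding t_def 2 using \<rho>[of 1 1] \<rho>[of 1 2] \<rho>[of 1 3] by (intro maps_T2) simp_all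
      moreover have "T2 (X 1) 1 1 = poly_at [:2, 4, 1:] (X 1) / X 1"
        unfolding poly by (simp add: T2_def)
      ultimately show ?thesis
        using val by (intro exI[of _ "\<rho> 1"] exI[of _ "[:2, 4, 1:]"]) simp
    next
      case 3
      have "maps (\<rho> 2) t (T3 1 (X 1) 1)"
        unfolding t_def 3 using \<rho>[of 2 1] \<rho>[of 2 2] \<rho>[of 2 3] by (intro maps_T3) simp_all
      moreover have "T3 1 (X 1) 1 = poly_at [:2, 2, 1:] (X 1) / X 1"
        unfolding poly by (simp add: T3_def)
      ultimately show ?thesis
        using val by (intro exI[of _ "\<rho> 2"] exI[of _ "[:2, 2, 1:]"]) simp
    qed
  qed
  then have "f \<in> poly_ring_of t" if "f \<in> ?I \<inter> laurent_ring" for f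
    using laurent_imp_poly_ring[of f t] that laurent subset by blast
  moreover have "f \<in> ?I \<inter> laurent_ring" if "f \<in> poly_ring_of t" for f
    using that laurent poly_at_in_field
    unfolding poly_ring_of_def I laurent_ring_eq by (auto intro: gen_ring_poly_at)
  ultimately show "?I \<inter> laurent_ring = poly_ring_of t"
    by blast
qed

theorem theorem6p4:
  fixes B :: "int^3^3" and T :: "ratfun \<Rightarrow> ratfun \<Rightarrow> ratfun \<Rightarrow> ratfun"
  assumes "(B, T) \<in> {(B1, T1), (B2, T2), (B3, T3)}"
  shows "invariant_field B = ratfun_field_of (T (X 1) (X 2) (X 3))
    \<and> invariant_field B \<inter> laurent_ring = poly_ring_of (T (X 1) (X 2) (X 3))
    \<and> (\<forall>\<sigma> :: 3 \<Rightarrow> 3. \<sigma> permutes UNIV \<longrightarrow>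
         (\<forall>f. laurent_mutation_invariant (permute_matrix \<sigma> B) f \<longrightarrow>
            (\<exists>p :: rat poly. f = poly_at p (T (X (\<sigma> 1)) (X (\<sigma> 2)) (X (\<sigma> 3))))))"
proof -
  have "permute_matrix id B = B"
    by (simp add: permute_matrix_def vec_eq_iff)
  moreover have "\<exists>p. f = poly_at p (T (X (\<sigma> 1)) (X (\<sigma> 2)) (X (\<sigma> 3)))"
    if "\<sigma> permutes UNIV" "laurent_mutation_invariant (permute_matrix \<sigma> B) f" for \<sigma> f
    using that permuted_invariants(2)[OF that(1) assms]
    unfolding laurent_mutation_invariant_def poly_ring_of_def by blast
  ultimately show ?thesis
    using permuted_invariants[OF permutes_id assms] by simp
qed

end
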